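(* Let $d\ge 1$, $\alpha\in(0,2)$, let $V:\mathbb{R}^d\to\mathbb{R}$ be a locally bounded Borel measurable function with $e^{-V}\in L^1(dx)$, and let $\mu_V$, $\mathscr{E}_{\alpha,V}$, $k$, $K$, $\Phi$, $\Phi^{-1}$ be as defined in the context. (1) Suppose that $$\liminf_{|x|\to\infty}\frac{\inf_{|x|-1\le |z|\le |x|-1/2}e^{-V(z)}}{\sup_{|x|\le |z|\le |x|+1}e^{-V(z)}}>\frac{1}{\alpha}2^{2d+1}(e+e^{1/2})(2^\alpha-1).$$ Then the Poincaré inequality $$\mu_V(f^2)\le C_1\,\mathscr{E}_{\alpha,V}(f,f),\qquad f\in C_b^\infty(\mathbb{R}^d),\ \mu_V(f)=0,$$ holds for some constant $C_1>0$. (2) If $$\liminf_{|x|\to\infty}\frac{\inf_{|x|-1\le |z|\le |x|-1/2}e^{-V(z)}}{\sup_{|x|\le |z|\le |x|+1}e^{-V(z)}}=\infty,$$ then there exist constants $C_2,C_3>0$ such that the super Poincaré inequality $$\mu_V(f^2)\le s\,\mathscr{E}_{\alpha,V}(f,f)+\beta(s)\,\mu_V(|f|)^2,\qquad s>0,\ f\in C_b^\infty(\mathbb{R}^d),$$ holds, where $$\beta(s)=C_2\Big((1+s^{-d/\alpha})\,[\Phi^{-1}(C_3s^{-1})]^{d+d^2/\alpha}\,[K(\Phi^{-1}(C_3s^{-1}))]^{1+d/\alpha}\,[k(\Phi^{-1}(C_3s^{-1}))]^{-2-d/\alpha}\Big).$$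
   Context: $C_b^\infty(\mathbb{R}^d)$ is the set of smooth functions with bounded derivatives of every order. $\mu_V(dx)=C_Ve^{-V(x)}\,dx$ with $C_V=\big(\int e^{-V(x)}dx\big)^{-1}$ is a probability measure, and $\mu_V(g):=\int g\,d\mu_V$. The form is $$\mathscr{E}_{\alpha,V}(f,f):=\frac12\iint_{\{|x-y|\le 1\}}\frac{(f(x)-f(y))^2}{|x-y|^{d+\alpha}}\,dy\,\mu_V(dx).$$ For $r>0$, $$k(r):=\inf_{|x|\le r+1}e^{-V(x)},\qquad K(r):=\sup_{|x|\le r}e^{-V(x)},\qquad \Phi(r):=\inf_{|x|\ge r}\Big(e^{V(x)}\inf_{|x|-1\le|z|\le|x|-1/2}e^{-V(z)}\Big),$$ and $\Phi^{-1}$ denotes the inverse of the nondecreasing function $\Phi$. *)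

theory Defs
  imports "HOL-Analysis.Analysis"
begin

definition locally_bounded :: "('a::metric_space \<Rightarrow> real) \<Rightarrow> bool" where
  "locally_bounded V \<longleftrightarrow> (\<forall>S. compact S \<longrightarrow> bounded (V ` S))"

definition partial_deriv :: "'n::finite \<Rightarrow> (real^'n \<Rightarrow> real) \<Rightarrow> real^'n \<Rightarrow> real" where
  "partial_deriv i f x = frechet_derivative f (at x) (axis i 1)"

fun iter_partial :: "'n::finite list \<Rightarrow> (real^'n \<Rightarrow> real) \<Rightarrow> real^'n \<Rightarrow> real" where
  "iter_partial [] f = f"
| "iter_partial (i # is) f = partial_deriv i (iter_partial is f)"

text \<open>Smooth functions whose derivatives of every order are bounded; order 0 is included,
  so the functions themselves are bounded. Demanding (total) differentiability of every iterated
  partial derivative makes all of them continuous, i.e. gives smoothness.\<close>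

definition Cb_infty :: "(real^'n::finite \<Rightarrow> real) set" where
  "Cb_infty = {f. \<forall>is. (\<forall>x. iter_partial is f differentiable (at x))
                       \<and> bounded (range (iter_partial is f))}"

definition C_norm :: "(real^'n::finite \<Rightarrow> real) \<Rightarrow> real" where
  "C_norm V = inverse (LINT x|lborel. exp (- V x))"

definition mu :: "(real^'n::finite \<Rightarrow> real) \<Rightarrow> (real^'n) measure" where
  "mu V = density lborel (\<lambda>x. ennreal (C_norm V * exp (- V x)))"

text \<open>The integrand is \<open>0 / 0 = 0\<close> on the diagonal, which is a null set.\<close>

definition energy :: "real \<Rightarrow> (real^'n::finite \<Rightarrow> real) \<Rightarrow> (real^'n \<Rightarrow> real) \<Rightarrow> ennreal" where
  "energy \<alpha> V f = ennreal (1/2) *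
     (\<integral>\<^sup>+ x. (\<integral>\<^sup>+ y. ennreal ((f x - f y)\<^sup>2 / norm (x - y) powr (real CARD('n) + \<alpha>))
                     * indicator {y. norm (x - y) \<le> 1} y \<partial>lborel) \<partial>mu V)"

text \<open>The extended values follow the convention that the infimum of the empty set is \<open>\<infinity>\<close>;
  the set below is empty exactly when \<open>norm x < 1/2\<close>.\<close>

definition inner_inf :: "(real^'n::finite \<Rightarrow> real) \<Rightarrow> real^'n \<Rightarrow> ennreal" where
  "inner_inf V x =
     (INF z\<in>{z. norm x - 1 \<le> norm z \<and> norm z \<le> norm x - 1/2}. ennreal (exp (- V z)))"

definition outer_sup :: "(real^'n::finite \<Rightarrow> real) \<Rightarrow> real^'n \<Rightarrow> ennreal" where
  "outer_sup V x =
     (SUP z\<in>{z. norm x \<le> norm z \<and> norm z \<le> norm x + 1}. ennreal (exp (- V z)))"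

definition liminf_ratio :: "(real^'n::finite \<Rightarrow> real) \<Rightarrow> ennreal" where
  "liminf_ratio V = Liminf at_infinity (\<lambda>x. inner_inf V x / outer_sup V x)"

definition k_fun :: "(real^'n::finite \<Rightarrow> real) \<Rightarrow> real \<Rightarrow> real" where
  "k_fun V r = (INF x\<in>{x. norm x \<le> r + 1}. exp (- V x))"

definition K_fun :: "(real^'n::finite \<Rightarrow> real) \<Rightarrow> real \<Rightarrow> real" where
  "K_fun V r = (SUP x\<in>{x. norm x \<le> r}. exp (- V x))"

definition Phi :: "(real^'n::finite \<Rightarrow> real) \<Rightarrow> real \<Rightarrow> ennreal" where
  "Phi V r = (INF x\<in>{x. r \<le> norm x}. ennreal (exp (V x)) * inner_inf V x)"

text \<open>Generalised inverse of the nondecreasing function \<open>Phi V\<close>. Since \<open>inner_inf V x = \<infinity>\<close> for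
  \<open>norm x < 1/2\<close>, \<open>Phi V\<close> is constant on \<open>{0<..1/2}\<close>, equal to its minimum \<open>Phi V (1/2)\<close>. For \<open>t\<close> above this
  minimum the restriction \<open>r \<ge> 1/2\<close> is void and the definition is the usual \<open>inf {r > 0. t \<le> Phi V r}\<close>.
  For \<open>t\<close> at or below the minimum it gives the right endpoint \<open>1/2\<close> of the interval of constancy. The
  value \<open>0\<close> is to be avoided there: it lies outside the domain \<open>r > 0\<close> and would make the
  rate function \<open>beta\<close> below vanish for large \<open>s\<close>, contradicting the super Poincare inequality
  for \<open>f = 1\<close>.\<close>

definition Phi_inv :: "(real^'n::finite \<Rightarrow> real) \<Rightarrow> real \<Rightarrow> real" where
  "Phi_inv V t = Inf {r. 1/2 \<le> r \<and> ennreal t \<le> Phi V r}"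

definition beta :: "real \<Rightarrow> (real^'n::finite \<Rightarrow> real) \<Rightarrow> real \<Rightarrow> real \<Rightarrow> real \<Rightarrow> real" where
  "beta \<alpha> V C2 C3 s =
     (let d = real CARD('n); R = Phi_inv V (C3 * inverse s) in
        C2 * ((1 + s powr (- d / \<alpha>)) * R powr (d + d\<^sup>2 / \<alpha>)
              * K_fun V R powr (1 + d / \<alpha>) * k_fun V R powr (- 2 - d / \<alpha>)))"

end

theory Submission
  imports Defs
begin

text \<open>For \<open>\<sigma> \<ge> 1\<close> one has \<open>(1 - 1/\<sigma>) f(v)\<^sup>2 \<le> (f(u) - f(v))\<^sup>2 + (\<sigma> - 1) f(u)\<^sup>2\<close>. Multiply this by the
  weight \<open>e\<^sup>-\<^sup>V\<close> at \<open>u\<close> and integrate over the pairs for which \<open>v\<close> lies far out and \<open>u\<close> in the ball of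
  radius \<open>1/4\<close> about \<open>v - 3v/(4|v|)\<close>. With \<open>\<rho>\<close> the ratio in the hypothesis and up to the volume of
  the unit ball, the left hand side is at least \<open>(1 - 1/\<sigma>) 4\<^sup>-\<^sup>d \<rho>\<close> times the tail of \<open>\<mu>(f\<^sup>2)\<close>, and the
  right hand side is at most the energy plus \<open>(\<sigma> - 1) \<mu>(f\<^sup>2)\<close>. As soon as \<open>\<rho> > 4\<^sup>d\<close>, a suitable \<open>\<sigma>\<close> close to 1 lets the tail
  absorb its own contribution to the right. What remains is \<open>f\<close> on a ball, where \<open>e\<^sup>-\<^sup>V\<close> is bounded above and
  below: the variance there is controlled by jumps of length at most 1 through repeated
  insertion of midpoints, and the super Poincare inequality there follows by averaging over
  balls of a small radius \<open>\<epsilon>\<close>.\<close>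

section \<open>Jump forms on Euclidean space\<close>

text \<open>The weight sits at the starting point \<open>x\<close> only, and the singular kernel is
  replaced by the indicator of jumps of length at most \<open>\<epsilon>\<close>. On these jumps the
  kernel of \<open>energy\<close> is at least \<open>\<epsilon> powr (- d - \<alpha>)\<close>, so
  this form bounds \<open>energy\<close> from below up to a factor.\<close>

definition jump_energy :: "real \<Rightarrow> ('a::euclidean_space \<Rightarrow> real) \<Rightarrow> ('a \<Rightarrow> real) \<Rightarrow> ennreal" where
  "jump_energy \<epsilon> p f =
     (\<integral>\<^sup>+ x. (\<integral>\<^sup>+ y. ennreal (p x * (f x - f y)\<^sup>2) * indicator (cball 0 \<epsilon>) (x - y) \<partial>lborel) \<partial>lborel)"

lemma pred_mem_cball [measurable]:
  fixes f :: "'b \<Rightarrow> 'a::euclidean_space"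
  assumes [measurable]: "f \<in> borel_measurable M"
  shows "Measurable.pred M (\<lambda>x. f x \<in> cball 0 \<epsilon>)"
  unfolding mem_cball_0 by measurable

lemma jump_energy_diff_const: "jump_energy \<epsilon> p (\<lambda>x. f x - a) = jump_energy \<epsilon> p f"
  by (simp add: jump_energy_def)

lemma nn_integral_indicator_cball_diff:
  fixes x :: "'a::euclidean_space"
  assumes "0 \<le> \<epsilon>"
  shows "(\<integral>\<^sup>+ y. indicator (cball 0 \<epsilon>) (x - y) \<partial>lborel) =
    ennreal (unit_ball_vol (DIM('a)) * \<epsilon> ^ DIM('a))"
proof -
  have "(\<integral>\<^sup>+ y. indicator (cball 0 \<epsilon>) (x - y) \<partial>lborel) = (\<integral>\<^sup>+ y. indicator (cball x \<epsilon>) y \<partial>lborel)"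
    by (intro nn_integral_cong) (auto simp: indicator_def dist_norm norm_minus_commute)
  then show ?thesis
    using assms by (simp add: emeasure_cball)
qed

section \<open>Mass far out against jumps towards the origin\<close>

text \<open>The slack is the square \<open>(\<sigma> * a - b)\<^sup>2 / \<sigma>\<close>.\<close>

lemma weighted_square_le:
  fixes a b \<sigma> :: real
  assumes "1 \<le> \<sigma>"
  shows "(1 - 1 / \<sigma>) * b\<^sup>2 \<le> (a - b)\<^sup>2 + (\<sigma> - 1) * a\<^sup>2"
proof -
  have "(a - b)\<^sup>2 + (\<sigma> - 1) * a\<^sup>2 - (1 - 1 / \<sigma>) * b\<^sup>2 = (\<sigma> * a - b)\<^sup>2 / \<sigma>"
    using assms by (simp add: field_simps power2_eq_square)
  also have "\<dots> \<ge> 0" using assms by simp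
  finally show ?thesis by simp
qed

text \<open>Each \<open>v\<close> in \<open>S\<close> is compared with a ball of radius 1/4 inside
  the shell below it, which has volume \<open>b / 4 ^ DIM('a)\<close>. Enlarging to all pairs at
  distance at most 1 and exchanging the integrals leaves a unit ball of points \<open>v\<close> for
  each \<open>u\<close>, whence the factor \<open>b\<close> in the last term.\<close>

lemma outer_bound:
  fixes f p :: "'a::euclidean_space \<Rightarrow> real"
  assumes [measurable]: "f \<in> borel_measurable borel" "p \<in> borel_measurable borel" "S \<in> sets borel"
    and p: "\<And>x. 0 \<le> p x"
    and S: "\<And>v. v \<in> S \<Longrightarrow> 3/4 \<le> norm v"
    and \<theta>: "0 \<le> \<theta>"
      "\<And>u v. v \<in> S \<Longrightarrow> norm v - 1 \<le> norm u \<Longrightarrow> norm u \<le> norm v - 1/2 \<Longrightarrow> \<theta> * p v \<le> p u"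
    and \<sigma>: "1 \<le> \<sigma>"
  shows "ennreal ((1 - 1 / \<sigma>) * \<theta> * unit_ball_vol (DIM('a)) / 4 ^ DIM('a))
           * (\<integral>\<^sup>+ v. ennreal ((f v)\<^sup>2 * p v) * indicator S v \<partial>lborel)
         \<le> jump_energy 1 p f
           + ennreal ((\<sigma> - 1) * unit_ball_vol (DIM('a))) * (\<integral>\<^sup>+ x. ennreal ((f x)\<^sup>2 * p x) \<partial>lborel)"
proof -
  define b where "b = unit_ball_vol (DIM('a))"
  have b: "0 \<le> b" by (simp add: b_def)
  have \<sigma>': "0 \<le> 1 - 1 / \<sigma>" using \<sigma> by simp
  define G where "G u v = (ennreal (p u * (f u - f v)\<^sup>2) + ennreal ((\<sigma> - 1) * ((f u)\<^sup>2 * p u)))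
      * indicator (cball 0 1) (u - v)" for u v
  have [measurable]: "case_prod G \<in> borel_measurable (lborel \<Otimes>\<^sub>M lborel)"
    unfolding G_def by measurable
  have *: "ennreal ((1 - 1 / \<sigma>) * \<theta> * b / 4 ^ DIM('a)) * (ennreal ((f v)\<^sup>2 * p v) * indicator S v)
      \<le> (\<integral>\<^sup>+ u. G u v \<partial>lborel)" for v
  proof (cases "v \<in> S")
    case True
    \<comment> \<open>The point on the segment from 0 to \<open>v\<close> at distance 3/4 from
      \<open>v\<close>. Every \<open>u\<close> within 1/4 of it has norm between
      \<open>norm v - 1\<close> and \<open>norm v - 1/2\<close> and distance at most 1 from
      \<open>v\<close>.\<close>
    define c where "c = (1 - 3 / (4 * norm v)) *\<^sub>R v"
    have nv: "3/4 \<le> norm v" by (rule S[OF True])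
    have "0 < norm v" using nv by linarith
    then have "0 \<le> 1 - 3 / (4 * norm v)" using nv by (simp add: divide_le_eq)
    then have "norm c = (1 - 3 / (4 * norm v)) * norm v"
      unfolding c_def norm_scaleR by simp
    then have nc: "norm c = norm v - 3/4"
      using \<open>0 < norm v\<close> by (simp add: left_diff_distrib)
    have "v - c = (3 / (4 * norm v)) *\<^sub>R v"
      unfolding c_def by (simp add: algebra_simps)
    then have "norm (v - c) = 3 / (4 * norm v) * norm v"
      by (metis norm_scaleR abs_of_nonneg \<open>0 < norm v\<close> divide_nonneg_nonneg less_imp_le
          mult_nonneg_nonneg zero_le_numeral)
    then have nvc: "norm (v - c) = 3/4" using \<open>0 < norm v\<close> by (auto simp: field_simps)
    have "ennreal ((1 - 1 / \<sigma>) * \<theta> * (f v)\<^sup>2 * p v) * indicator (cball c (1/4)) u \<le> G u v" for u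
    proof (cases "u \<in> cball c (1/4)")
      case u: True
      then have d: "norm (u - c) \<le> 1/4" by (simp add: dist_norm norm_minus_commute)
      have uv: "norm (u - v) \<le> 1"
        using norm_triangle_ineq4[of "u - c" "v - c"] d nvc by simp
      have nu: "norm u \<le> norm v - 1/2"
        using norm_triangle_ineq[of "u - c" c] d nc by simp
      have nu': "norm v - 1 \<le> norm u"
        using norm_triangle_ineq2[of v u] uv by (simp add: norm_minus_commute)
      have "(1 - 1 / \<sigma>) * \<theta> * (f v)\<^sup>2 * p v = ((1 - 1 / \<sigma>) * (f v)\<^sup>2) * (\<theta> * p v)"
        by simp
      \<comment> \<open>The shell hypothesis moves the weight from \<open>v\<close> to
        \<open>u\<close>, the point that carries it in \<open>jump_energy\<close>.\<close>
      also have "\<dots> \<le> ((1 - 1 / \<sigma>) * (f v)\<^sup>2) * p u"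
        by (intro mult_left_mono \<theta>(2) True nu nu' mult_nonneg_nonneg \<sigma>') auto
      also have "\<dots> \<le> ((f u - f v)\<^sup>2 + (\<sigma> - 1) * (f u)\<^sup>2) * p u"
        by (intro mult_right_mono weighted_square_le \<sigma> p)
      also have "\<dots> = p u * (f u - f v)\<^sup>2 + (\<sigma> - 1) * ((f u)\<^sup>2 * p u)"
        by (simp add: algebra_simps)
      finally have "ennreal ((1 - 1 / \<sigma>) * \<theta> * (f v)\<^sup>2 * p v) \<le>
          ennreal (p u * (f u - f v)\<^sup>2) + ennreal ((\<sigma> - 1) * ((f u)\<^sup>2 * p u))"
        using p \<sigma> by (simp add: ennreal_leI flip: ennreal_plus)
      then show ?thesis using u uv by (simp add: G_def)
    qed (auto simp: G_def)
    then have "(\<integral>\<^sup>+ u. ennreal ((1 - 1 / \<sigma>) * \<theta> * (f v)\<^sup>2 * p v) * indicator (cball c (1/4)) u \<partial>lborel)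
        \<le> (\<integral>\<^sup>+ u. G u v \<partial>lborel)"
      by (intro nn_integral_mono)
    moreover have "(\<integral>\<^sup>+ u. ennreal ((1 - 1 / \<sigma>) * \<theta> * (f v)\<^sup>2 * p v) * indicator (cball c (1/4)) u \<partial>lborel)
        = ennreal ((1 - 1 / \<sigma>) * \<theta> * (f v)\<^sup>2 * p v) * ennreal (b * (1/4) ^ DIM('a))"
      by (simp add: nn_integral_cmult_indicator emeasure_cball b_def)
    moreover have "\<dots> = ennreal ((1 - 1 / \<sigma>) * \<theta> * b / 4 ^ DIM('a)) * ennreal ((f v)\<^sup>2 * p v)"
    proof -
      have "0 \<le> (1 - 1 / \<sigma>) * \<theta> * (f v)\<^sup>2 * p v" "0 \<le> (1 - 1 / \<sigma>) * \<theta> * b / 4 ^ DIM('a)"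
        using \<sigma>' \<theta>(1) p[of v] b by auto
      moreover have "(1 - 1 / \<sigma>) * \<theta> * (f v)\<^sup>2 * p v * (b * (1/4) ^ DIM('a))
          = (1 - 1 / \<sigma>) * \<theta> * b / 4 ^ DIM('a) * ((f v)\<^sup>2 * p v)"
        by (simp add: power_one_over)
      ultimately show ?thesis by (metis ennreal_mult')
    qed
    ultimately show ?thesis using True by simp
  qed simp
  have "ennreal ((1 - 1 / \<sigma>) * \<theta> * b / 4 ^ DIM('a)) * (\<integral>\<^sup>+ v. ennreal ((f v)\<^sup>2 * p v) * indicator S v \<partial>lborel)
    = (\<integral>\<^sup>+ v. ennreal ((1 - 1 / \<sigma>) * \<theta> * b / 4 ^ DIM('a)) * (ennreal ((f v)\<^sup>2 * p v) * indicator S v) \<partial>lborel)"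
    by (intro nn_integral_cmult[symmetric]) measurable
  also have "\<dots> \<le> (\<integral>\<^sup>+ v. (\<integral>\<^sup>+ u. G u v \<partial>lborel) \<partial>lborel)"
    by (intro nn_integral_mono *)
  also have "\<dots> = (\<integral>\<^sup>+ u. (\<integral>\<^sup>+ v. G u v \<partial>lborel) \<partial>lborel)"
    by (rule lborel_pair.Fubini') measurable
  also have "\<dots> = (\<integral>\<^sup>+ u. (\<integral>\<^sup>+ v. ennreal (p u * (f u - f v)\<^sup>2) * indicator (cball 0 1) (u - v) \<partial>lborel)
      + ennreal ((\<sigma> - 1) * b) * ennreal ((f u)\<^sup>2 * p u) \<partial>lborel)"
  proof (intro nn_integral_cong)
    fix u :: 'a
    have "(\<integral>\<^sup>+ v. G u v \<partial>lborel) = (\<integral>\<^sup>+ v. ennreal (p u * (f u - f v)\<^sup>2) * indicator (cball 0 1) (u - v) \<partial>lborel)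
       + (\<integral>\<^sup>+ v. ennreal ((\<sigma> - 1) * ((f u)\<^sup>2 * p u)) * indicator (cball 0 1) (u - v) \<partial>lborel)"
      unfolding G_def distrib_right by (intro nn_integral_add) measurable
    also have "(\<integral>\<^sup>+ v. ennreal ((\<sigma> - 1) * ((f u)\<^sup>2 * p u)) * indicator (cball 0 1) (u - v) \<partial>lborel)
      = ennreal ((\<sigma> - 1) * b) * ennreal ((f u)\<^sup>2 * p u)"
      using \<sigma> p[of u] b
      by (subst nn_integral_cmult)
        (simp_all add: nn_integral_indicator_cball_diff b_def[symmetric] ennreal_mult[symmetric] mult_ac)
    finally show "(\<integral>\<^sup>+ v. G u v \<partial>lborel) = (\<integral>\<^sup>+ v. ennreal (p u * (f u - f v)\<^sup>2) * indicator (cball 0 1) (u - v) \<partial>lborel)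
       + ennreal ((\<sigma> - 1) * b) * ennreal ((f u)\<^sup>2 * p u)" .
  qed
  also have "\<dots> = jump_energy 1 p f + ennreal ((\<sigma> - 1) * b) * (\<integral>\<^sup>+ x. ennreal ((f x)\<^sup>2 * p x) \<partial>lborel)"
    unfolding jump_energy_def by (subst nn_integral_add) (auto simp: nn_integral_cmult)
  finally show ?thesis unfolding b_def .
qed

section \<open>Chaining short jumps through midpoints\<close>

text \<open>Substitution \<open>y = - x + 2 *\<^sub>R z\<close>, whose Jacobian is
  \<open>2 ^ DIM('a)\<close>.\<close>

lemma nn_integral_midpoint:
  fixes g :: "'a::euclidean_space \<Rightarrow> ennreal"
  assumes [measurable]: "g \<in> borel_measurable borel"
  shows "(\<integral>\<^sup>+ y. g ((1/2) *\<^sub>R (x + y)) \<partial>lborel) = 2 ^ DIM('a) * (\<integral>\<^sup>+ y. g y \<partial>lborel)"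
proof -
  have "(\<integral>\<^sup>+ y. g ((1/2) *\<^sub>R (x + y)) \<partial>lborel) = 
    (\<integral>\<^sup>+ y. g ((1/2) *\<^sub>R (x + y)) \<partial>density (distr lborel borel (\<lambda>z. - x + 2 *\<^sub>R z)) (\<lambda>_. ennreal (\<bar>2\<bar>^DIM('a))))"
    by (subst lborel_affine[of 2 "- x"]) auto
  also have "\<dots> = (\<integral>\<^sup>+ z. ennreal (2 ^ DIM('a)) * g z \<partial>lborel)"
    by (subst nn_integral_density) (auto simp: nn_integral_distr)
  also have "\<dots> = 2 ^ DIM('a) * (\<integral>\<^sup>+ y. g y \<partial>lborel)"
    by (simp add: nn_integral_cmult ennreal_power[symmetric])
  finally show ?thesis .
qed

text \<open>Lebesgue measure replaces the weight and both points are confined to \<open>B\<close>.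
  On a convex \<open>B\<close> midpoints stay inside, and once \<open>\<rho>\<close> reaches the
  diameter of \<open>B\<close> the restriction on the length is void.\<close>

definition local_form :: "('a::euclidean_space \<Rightarrow> real) \<Rightarrow> 'a set \<Rightarrow> real \<Rightarrow> ennreal" where
  "local_form f B \<rho> = (\<integral>\<^sup>+ x. (\<integral>\<^sup>+ y. ennreal ((f x - f y)\<^sup>2)
      * (indicator B x * indicator B y * indicator (cball 0 \<rho>) (x - y)) \<partial>lborel) \<partial>lborel)"

text \<open>A jump is split at its midpoint \<open>m\<close> into two of half the length, with
  \<open>(f x - f y)\<^sup>2 \<le> 2 * (f x - f m)\<^sup>2 + 2 * (f y - f m)\<^sup>2\<close>. The
  constant collects 2 from this inequality, 2 for the two halves and \<open>2 ^ DIM('a)\<close> for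
  passing from an endpoint to the midpoint.\<close>

lemma local_form_double:
  fixes f :: "'a::euclidean_space \<Rightarrow> real"
  assumes [measurable]: "f \<in> borel_measurable borel" "B \<in> sets borel" and "convex B"
  shows "local_form f B (2 * \<rho>) \<le> 4 * 2 ^ DIM('a) * local_form f B \<rho>"
proof -
  define g where "g x y = ennreal (2 * (f x - f y)\<^sup>2)
      * (indicator B x * indicator B y * indicator (cball 0 \<rho>) (x - y))" for x y :: 'a
  have [measurable]: "case_prod g \<in> borel_measurable (lborel \<Otimes>\<^sub>M lborel)"
    "case_prod g \<in> borel_measurable (borel \<Otimes>\<^sub>M borel)"
    unfolding g_def by measurable
  have *: "ennreal ((f x - f y)\<^sup>2) * (indicator B x * indicator B y * indicator (cball 0 (2 * \<rho>)) (x - y))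
    \<le> g x ((1/2) *\<^sub>R (x + y)) + g y ((1/2) *\<^sub>R (y + x))" (is "_ \<le> ?r") for x y
  proof (cases "x \<in> B \<and> y \<in> B \<and> norm (x - y) \<le> 2 * \<rho>")
    case True
    define m where "m = (1/2) *\<^sub>R (x + y)"
    have "m \<in> B" using True convexD[OF assms(3), of x y "1/2" "1/2"]
      by (simp add: m_def scaleR_add_right)
    moreover have "x - m = (1/2) *\<^sub>R (x - y)" "y - m = (1/2) *\<^sub>R (y - x)"
      unfolding m_def by (simp_all add: algebra_simps flip: scaleR_add_left)
    then have "norm (x - m) \<le> \<rho>" "norm (y - m) \<le> \<rho>"
      using True by (simp_all add: norm_minus_commute)
    ultimately have "?r = ennreal (2 * (f x - f m)\<^sup>2 + 2 * (f y - f m)\<^sup>2)"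
      using True by (simp add: g_def m_def[symmetric] add.commute[of y x])
    moreover have "(f x - f y)\<^sup>2 \<le> 2 * (f x - f m)\<^sup>2 + 2 * (f y - f m)\<^sup>2"
      using zero_le_power2[of "f x + f y - 2 * f m"] by (simp add: power2_eq_square algebra_simps)
    ultimately show ?thesis using True by (simp add: ennreal_leI flip: ennreal_plus)
  qed (auto simp: indicator_def)
  have g2: "(\<integral>\<^sup>+ x. integral\<^sup>N lborel (g x) \<partial>lborel) = 2 * local_form f B \<rho>"
    unfolding g_def[abs_def] local_form_def
    by (simp add: ennreal_mult mult.assoc nn_integral_cmult)
  have mid: "(\<integral>\<^sup>+ y. g x ((1/2) *\<^sub>R (x + y)) \<partial>lborel) = 2 ^ DIM('a) * (\<integral>\<^sup>+ y. g x y \<partial>lborel)" for x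
    by (rule nn_integral_midpoint) measurable
  have "local_form f B (2 * \<rho>) \<le> (\<integral>\<^sup>+ x. (\<integral>\<^sup>+ y. g x ((1/2) *\<^sub>R (x + y)) + g y ((1/2) *\<^sub>R (y + x)) \<partial>lborel) \<partial>lborel)"
    unfolding local_form_def by (intro nn_integral_mono *)
  also have "\<dots> = (\<integral>\<^sup>+ x. (\<integral>\<^sup>+ y. g x ((1/2) *\<^sub>R (x + y)) \<partial>lborel) \<partial>lborel)
      + (\<integral>\<^sup>+ x. (\<integral>\<^sup>+ y. g y ((1/2) *\<^sub>R (y + x)) \<partial>lborel) \<partial>lborel)"
    by (simp add: nn_integral_add)
  \<comment> \<open>After the exchange the second term is the first one with its variables
    renamed.\<close>
  also have "(\<integral>\<^sup>+ x. (\<integral>\<^sup>+ y. g y ((1/2) *\<^sub>R (y + x)) \<partial>lborel) \<partial>lborel) 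
      = (\<integral>\<^sup>+ y. (\<integral>\<^sup>+ x. g y ((1/2) *\<^sub>R (y + x)) \<partial>lborel) \<partial>lborel)"
    by (intro lborel_pair.Fubini') measurable
  also have "(\<integral>\<^sup>+ x. (\<integral>\<^sup>+ y. g x ((1/2) *\<^sub>R (x + y)) \<partial>lborel) \<partial>lborel) = 2 ^ DIM('a) * (2 * local_form f B \<rho>)"
    unfolding mid by (simp add: nn_integral_cmult g2)
  finally show ?thesis by (simp add: mult.left_commute mult.assoc flip: mult_2)
qed

lemma local_form_power_two:
  fixes f :: "'a::euclidean_space \<Rightarrow> real"
  assumes [measurable]: "f \<in> borel_measurable borel" "B \<in> sets borel" and "convex B"
  shows "local_form f B (2 ^ k) \<le> (4 * 2 ^ DIM('a)) ^ k * local_form f B 1"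
proof (induction k)
  case (Suc k)
  have "local_form f B (2 ^ Suc k) \<le> 4 * 2 ^ DIM('a) * local_form f B (2 ^ k)"
    using local_form_double[OF assms] by simp
  also have "\<dots> \<le> 4 * 2 ^ DIM('a) * ((4 * 2 ^ DIM('a)) ^ k * local_form f B 1)"
    by (intro mult_left_mono Suc) simp
  finally show ?case by (simp add: mult_ac)
qed simp

lemma local_form_le_jump_energy:
  fixes f :: "'a::euclidean_space \<Rightarrow> real"
  assumes [measurable]: "f \<in> borel_measurable borel" "p \<in> borel_measurable borel" "B \<in> sets borel"
    and \<kappa>: "0 \<le> \<kappa>" "\<And>x. x \<in> B \<Longrightarrow> \<kappa> \<le> p x"
  shows "ennreal \<kappa> * local_form f B \<rho> \<le> jump_energy \<rho> p f"
proof -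
  have "ennreal \<kappa> * local_form f B \<rho> = (\<integral>\<^sup>+ x. (\<integral>\<^sup>+ y. ennreal \<kappa> * (ennreal ((f x - f y)\<^sup>2)
      * (indicator B x * indicator B y * indicator (cball 0 \<rho>) (x - y))) \<partial>lborel) \<partial>lborel)"
    unfolding local_form_def by (simp add: nn_integral_cmult)
  also have "\<dots> \<le> jump_energy \<rho> p f" unfolding jump_energy_def
    by (intro nn_integral_mono)
       (auto simp: indicator_def mult_right_mono \<kappa> simp flip: ennreal_mult' intro!: ennreal_leI)
  finally show ?thesis .
qed

section \<open>Averaging over small balls\<close>

text \<open>Integrate \<open>(f x)\<^sup>2 \<le> (f x - f y)\<^sup>2 + 2 * f x * f y\<close> over
  the \<open>y\<close> within \<open>\<epsilon>\<close> of \<open>x\<close>. Without the restriction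
  on the distance, the product term factors into the square of the \<open>L^1\<close> norm. As
  \<open>y\<close> may leave the ball of radius \<open>r\<close>, the lower bound on
  \<open>p\<close> is required up to \<open>r + 1\<close>, the radius built into
  \<open>k_fun\<close>.\<close>

lemma local_nash:
  fixes f p :: "'a::euclidean_space \<Rightarrow> real"
  assumes [measurable]: "f \<in> borel_measurable borel" "p \<in> borel_measurable borel"
    and p: "\<And>x. 0 \<le> p x"
    and \<epsilon>: "0 \<le> \<epsilon>" "\<epsilon> \<le> 1"
    and \<kappa>: "0 < \<kappa>" "\<And>x. norm x \<le> r + 1 \<Longrightarrow> \<kappa> \<le> p x"
    and M: "0 \<le> M" "\<And>x. norm x \<le> r \<Longrightarrow> p x \<le> M"
  shows "ennreal (unit_ball_vol (DIM('a)) * \<epsilon> ^ DIM('a))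
           * (\<integral>\<^sup>+ x. ennreal ((f x)\<^sup>2 * p x) * indicator (cball 0 r) x \<partial>lborel)
         \<le> ennreal (M / \<kappa>) * jump_energy \<epsilon> p f
           + ennreal (2 * M / \<kappa>\<^sup>2) * (\<integral>\<^sup>+ x. ennreal (\<bar>f x\<bar> * p x) \<partial>lborel)\<^sup>2"
proof -
  define I where "I = (\<integral>\<^sup>+ x. ennreal (\<bar>f x\<bar> * p x) \<partial>lborel)"
  have *: "ennreal ((f x)\<^sup>2 * p x) * indicator (cball 0 r) x * indicator (cball 0 \<epsilon>) (x - y)
     \<le> ennreal (M / \<kappa>) * (ennreal (p x * (f x - f y)\<^sup>2) * indicator (cball 0 \<epsilon>) (x - y))
        + ennreal (2 * M / \<kappa>\<^sup>2) * (ennreal (\<bar>f x\<bar> * p x) * ennreal (\<bar>f y\<bar> * p y))" for x y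
  proof (cases "norm x \<le> r \<and> norm (x - y) \<le> \<epsilon>")
    case True
    then have "norm y \<le> r + 1" 
      using norm_triangle_ineq4[of x "x - y"] \<epsilon> by simp
    then have k: "\<kappa> \<le> p x" "\<kappa> \<le> p y" using True \<kappa> by auto
    have "(f x)\<^sup>2 \<le> (f x - f y)\<^sup>2 + 2 * (f x * f y)"
      using zero_le_power2[of "f y"] by (simp add: power2_eq_square algebra_simps)
    also have "f x * f y \<le> \<bar>f x\<bar> * \<bar>f y\<bar>" by (metis abs_ge_self abs_mult)
    finally have 1: "(f x)\<^sup>2 \<le> (f x - f y)\<^sup>2 + 2 * (\<bar>f x\<bar> * \<bar>f y\<bar>)" by simp
    have "(f x)\<^sup>2 * p x \<le> (f x)\<^sup>2 * M" using True M by (intro mult_left_mono) auto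
    also have "\<dots> \<le> ((f x - f y)\<^sup>2 + 2 * (\<bar>f x\<bar> * \<bar>f y\<bar>)) * M"
      using 1 M by (intro mult_right_mono) auto
    \<comment> \<open>The factors \<open>\<kappa>\<close> are inserted in order to be raised to
      \<open>p x\<close> and \<open>p y\<close>; a weight at both points costs
      \<open>1 / \<kappa>\<^sup>2\<close>.\<close>
    also have "\<dots> = M / \<kappa> * (\<kappa> * (f x - f y)\<^sup>2) + 2 * M / \<kappa>\<^sup>2 * ((\<bar>f x\<bar> * \<kappa>) * (\<bar>f y\<bar> * \<kappa>))"
      using \<kappa>(1) by (simp add: field_simps power2_eq_square)
    also have "\<dots> \<le> M / \<kappa> * (p x * (f x - f y)\<^sup>2) + 2 * M / \<kappa>\<^sup>2 * ((\<bar>f x\<bar> * p x) * (\<bar>f y\<bar> * p y))"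
      using k \<kappa> M p by (intro add_mono mult_left_mono mult_mono mult_right_mono) auto
    finally show ?thesis using True M \<kappa> p
      by (simp add: ennreal_leI flip: ennreal_mult ennreal_plus)
  qed (auto simp: indicator_def)
  have **: "(\<integral>\<^sup>+ y. ennreal ((f x)\<^sup>2 * p x) * indicator (cball 0 r) x * indicator (cball 0 \<epsilon>) (x - y) \<partial>lborel)
    = ennreal (unit_ball_vol (DIM('a)) * \<epsilon> ^ DIM('a)) * (ennreal ((f x)\<^sup>2 * p x) * indicator (cball 0 r) x)" for x
    by (subst nn_integral_cmult) (auto simp: nn_integral_indicator_cball_diff \<epsilon> mult_ac)
  have "ennreal (unit_ball_vol (DIM('a)) * \<epsilon> ^ DIM('a))
           * (\<integral>\<^sup>+ x. ennreal ((f x)\<^sup>2 * p x) * indicator (cball 0 r) x \<partial>lborel)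
     = (\<integral>\<^sup>+ x. (\<integral>\<^sup>+ y. ennreal ((f x)\<^sup>2 * p x) * indicator (cball 0 r) x * indicator (cball 0 \<epsilon>) (x - y) \<partial>lborel) \<partial>lborel)"
    unfolding ** by (simp add: nn_integral_cmult)
  also have "\<dots> \<le> (\<integral>\<^sup>+ x. (\<integral>\<^sup>+ y. ennreal (M / \<kappa>) * (ennreal (p x * (f x - f y)\<^sup>2) * indicator (cball 0 \<epsilon>) (x - y))
        + ennreal (2 * M / \<kappa>\<^sup>2) * (ennreal (\<bar>f x\<bar> * p x) * ennreal (\<bar>f y\<bar> * p y)) \<partial>lborel) \<partial>lborel)"
    by (intro nn_integral_mono *)
  also have "\<dots> = (\<integral>\<^sup>+ x. ennreal (M / \<kappa>) * (\<integral>\<^sup>+ y. ennreal (p x * (f x - f y)\<^sup>2) * indicator (cball 0 \<epsilon>) (x - y) \<partial>lborel)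
        + ennreal (2 * M / \<kappa>\<^sup>2) * (ennreal (\<bar>f x\<bar> * p x) * I) \<partial>lborel)"
    unfolding I_def by (intro nn_integral_cong) (simp add: nn_integral_add nn_integral_cmult)
  also have "\<dots> = ennreal (M / \<kappa>) * jump_energy \<epsilon> p f + ennreal (2 * M / \<kappa>\<^sup>2) * (I * I)"
    unfolding jump_energy_def I_def
    by (simp add: nn_integral_add nn_integral_cmult nn_integral_multc)
  finally show ?thesis unfolding I_def[symmetric] by (simp add: power2_eq_square)
qed

section \<open>Joining the tail and the ball\<close>

text \<open>With \<open>X\<close> the tail and \<open>Y\<close> the ball part of the second moment,
  \<open>outer_bound\<close> gives \<open>A * X \<le> J + B * (X + Y)\<close> with
  \<open>B < A\<close>, where \<open>J\<close> is the jump energy. Finiteness of the second moment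
  allows \<open>B * X\<close> to be subtracted.\<close>

lemma lyapunov_bound:
  fixes p :: "'a::euclidean_space \<Rightarrow> real"
  assumes [measurable]: "p \<in> borel_measurable borel"
    and p: "\<And>x. 0 \<le> p x"
    and R: "3/4 \<le> R"
    and \<theta>: "4 ^ DIM('a) < \<theta>"
      "\<And>u v. R < norm v \<Longrightarrow> norm v - 1 \<le> norm u \<Longrightarrow> norm u \<le> norm v - 1/2 \<Longrightarrow> \<theta> * p v \<le> p u"
  obtains c where "0 < c"
    "\<And>f. f \<in> borel_measurable borel \<Longrightarrow> (\<integral>\<^sup>+ x. ennreal ((f x)\<^sup>2 * p x) \<partial>lborel) < \<infinity> \<Longrightarrow>
      (\<integral>\<^sup>+ x. ennreal ((f x)\<^sup>2 * p x) \<partial>lborel) \<le>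
      ennreal c * (jump_energy 1 p f + (\<integral>\<^sup>+ x. ennreal ((f x)\<^sup>2 * p x) * indicator (cball 0 R) x \<partial>lborel))"
proof -
  define b where "b = unit_ball_vol (DIM('a))"
  have b: "0 < b" by (simp add: b_def)
  have \<theta>0: "0 \<le> \<theta>"
    using \<theta>(1) zero_le_power[of 4 "DIM('a)"] by (meson less_imp_le order_trans zero_le_numeral)
  define q where "q = \<theta> / 4 ^ DIM('a)"
  have q: "1 < q" using \<theta>(1) by (simp add: q_def)
  \<comment> \<open>The quotient of \<open>A\<close> by \<open>B\<close> is
    \<open>q / \<sigma>\<close>, so any \<open>\<sigma>\<close> strictly between 1 and
    \<open>q\<close> would do.\<close>
  define \<sigma> where "\<sigma> = (1 + q) / 2"
  have \<sigma>: "1 < \<sigma>" "\<sigma> < q" using q by (auto simp: \<sigma>_def)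
  define B where "B = (\<sigma> - 1) * b"
  have B: "0 < B" using \<sigma> b by (simp add: B_def)
  define A where "A = B * (q / \<sigma>)"
  have AB: "B < A" using \<sigma> B by (simp add: A_def less_divide_eq)
  \<comment> \<open>The fraction bounds the tail; the summand 1 accounts for the ball part.\<close>
  define c where "c = 1 + (1 + B) / (A - B)"
  have c: "0 < c" using AB B by (simp add: c_def add_pos_pos)
  show thesis
  proof (rule that[OF c])
    fix f :: "'a \<Rightarrow> real"
    assume f [measurable]: "f \<in> borel_measurable borel"
      and fin: "(\<integral>\<^sup>+ x. ennreal ((f x)\<^sup>2 * p x) \<partial>lborel) < \<infinity>"
    define T where "T = (\<integral>\<^sup>+ x. ennreal ((f x)\<^sup>2 * p x) \<partial>lborel)"
    define X where "X = (\<integral>\<^sup>+ x. ennreal ((f x)\<^sup>2 * p x) * indicator (- cball 0 R) x \<partial>lborel)"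
    define Y where "Y = (\<integral>\<^sup>+ x. ennreal ((f x)\<^sup>2 * p x) * indicator (cball 0 R) x \<partial>lborel)"
    have T: "T = X + Y"
      unfolding T_def X_def Y_def
      by (subst nn_integral_add[symmetric]) (auto intro!: nn_integral_cong simp: indicator_def)
    have main: "ennreal A * X \<le> jump_energy 1 p f + ennreal B * T"
    proof -
      have "(1 - 1 / \<sigma>) * \<theta> * b / 4 ^ DIM('a) = A"
        using \<sigma> by (simp add: A_def B_def q_def field_simps)
      then show ?thesis
        using outer_bound[of f p "- cball 0 R" \<theta> \<sigma>] p R \<theta> \<theta>0 \<sigma>
        unfolding X_def T_def B_def b_def by auto
    qed
    show "T \<le> ennreal c * (jump_energy 1 p f + Y)"
    proof (cases "jump_energy 1 p f")
      case (real j)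
      from fin T obtain x y where xy: "X = ennreal x" "Y = ennreal y" "0 \<le> x" "0 \<le> y"
        unfolding T_def[symmetric] by (cases X; cases Y) auto
      have "A * x \<le> j + B * (x + y)"
        using main real xy B AB by (simp add: T flip: ennreal_plus ennreal_mult)
      then have "(A - B) * x \<le> j + B * y" by (simp add: algebra_simps)
      also have "\<dots> \<le> (1 + B) * (j + y)" using B xy real by (simp add: algebra_simps)
      finally have "x \<le> (1 + B) / (A - B) * (j + y)" using AB by (simp add: field_simps)
      then have "x + y \<le> c * (j + y)" using real by (simp add: c_def algebra_simps)
      then show ?thesis
        using xy real c by (simp add: T flip: ennreal_plus ennreal_mult)
    next
      case top
      then show ?thesis using c by (simp add: ennreal_mult_top)
    qed
  qed
qed

text \<open>\<open>lyapunov_bound\<close> is applied to \<open>f - f y\<close> and averaged over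
  \<open>y\<close> in the ball of radius \<open>R\<close>. The ball term becomes a double integral
  of \<open>(f x - f y)\<^sup>2\<close>, which the midpoint chain reduces to jumps of length at most
  1. \<open>T\<close> is any common lower bound of the second moments of \<open>f - a\<close>, such
  as the variance.\<close>

lemma variance_le_jump_energy:
  fixes p :: "'a::euclidean_space \<Rightarrow> real"
  assumes [measurable]: "p \<in> borel_measurable borel"
    and p: "\<And>x. 0 \<le> p x"
    and R: "3/4 \<le> R"
    and \<theta>: "4 ^ DIM('a) < \<theta>"
      "\<And>u v. R < norm v \<Longrightarrow> norm v - 1 \<le> norm u \<Longrightarrow> norm u \<le> norm v - 1/2 \<Longrightarrow> \<theta> * p v \<le> p u"
    and \<kappa>: "0 < \<kappa>" "\<And>x. norm x \<le> R \<Longrightarrow> \<kappa> \<le> p x"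
    and M: "\<And>x. norm x \<le> R \<Longrightarrow> p x \<le> M"
  obtains c where "0 < c"
    "\<And>f T. f \<in> borel_measurable borel \<Longrightarrow> 
      (\<And>a. (\<integral>\<^sup>+ x. ennreal ((f x - a)\<^sup>2 * p x) \<partial>lborel) < \<infinity>) \<Longrightarrow>
      (\<And>a. T \<le> (\<integral>\<^sup>+ x. ennreal ((f x - a)\<^sup>2 * p x) \<partial>lborel)) \<Longrightarrow>
      T \<le> ennreal c * jump_energy 1 p f"
proof -
  obtain c where c: "0 < c"
    "\<And>f. f \<in> borel_measurable borel \<Longrightarrow> (\<integral>\<^sup>+ x. ennreal ((f x)\<^sup>2 * p x) \<partial>lborel) < \<infinity> \<Longrightarrow>
      (\<integral>\<^sup>+ x. ennreal ((f x)\<^sup>2 * p x) \<partial>lborel) \<le>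
      ennreal c * (jump_energy 1 p f + (\<integral>\<^sup>+ x. ennreal ((f x)\<^sup>2 * p x) * indicator (cball 0 R) x \<partial>lborel))"
    using lyapunov_bound[OF assms(1-5)] by blast
  define B where "B = cball (0::'a) R"
  have [measurable]: "B \<in> sets borel" by (simp add: B_def)
  define m where "m = unit_ball_vol (DIM('a)) * R ^ DIM('a)"
  have m: "0 < m" using R by (simp add: m_def)
  have B: "emeasure lborel B = ennreal m" using R by (simp add: B_def m_def emeasure_cball)
  have "0 < M" using \<kappa>(1) \<kappa>(2)[of 0] M[of 0] R by simp
  \<comment> \<open>Two points of \<open>B\<close> are at most \<open>2 * R\<close> apart, so
    \<open>k\<close> doublings of the length 1 reach all pairs.\<close>
  obtain k where k: "2 * R < 2 ^ k" using real_arch_pow[of 2 "2 * R"] by auto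
  define N where "N = (4 * 2 ^ DIM('a)) ^ k / \<kappa>"
  have N: "0 < N" using \<kappa>(1) by (simp add: N_def)
  \<comment> \<open>Integration over \<open>y\<close> in \<open>B\<close> yields
    \<open>T * m \<le> (c * m + c * M * N) * J\<close>.\<close>
  define C where "C = (c * m + c * M * N) / m"
  have C: "0 < C" using c m \<open>0 < M\<close> N by (simp add: C_def add_pos_pos)
  show thesis
  proof (rule that[OF C])
    fix f :: "'a \<Rightarrow> real" and T :: ennreal
    assume [measurable]: "f \<in> borel_measurable borel"
      and fin: "\<And>a. (\<integral>\<^sup>+ x. ennreal ((f x - a)\<^sup>2 * p x) \<partial>lborel) < \<infinity>"
      and T: "\<And>a. T \<le> (\<integral>\<^sup>+ x. ennreal ((f x - a)\<^sup>2 * p x) \<partial>lborel)"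
    define J where "J = jump_energy 1 p f"
    have "local_form f B (2 ^ k) \<le> (4 * 2 ^ DIM('a)) ^ k * local_form f B 1"
      by (intro local_form_power_two) (auto simp: B_def)
    also have "\<dots> = ennreal N * (ennreal \<kappa> * local_form f B 1)"
      using \<kappa>(1) by (simp add: N_def flip: mult.assoc ennreal_mult)
        (simp add: ennreal_mult ennreal_power[symmetric])
    also have "\<dots> \<le> ennreal N * J"
      unfolding J_def using \<kappa> by (intro mult_left_mono local_form_le_jump_energy) (auto simp: B_def)
    finally have loc: "local_form f B (2 ^ k) \<le> ennreal N * J" .
    have bound: "T * indicator B y \<le> ennreal c * J * indicator B y
       + ennreal (c * M) * (\<integral>\<^sup>+ x. ennreal ((f y - f x)\<^sup>2) *
         (indicator B y * indicator B x * indicator (cball 0 (2 ^ k)) (y - x)) \<partial>lborel)" for y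
    proof (cases "y \<in> B")
      case True
      have "T \<le> ennreal c * (J + (\<integral>\<^sup>+ x. ennreal ((f x - f y)\<^sup>2 * p x) * indicator B x \<partial>lborel))"
        using T[of "f y"] c(2)[of "\<lambda>x. f x - f y"] fin[of "f y"]
        by (auto simp: J_def jump_energy_diff_const B_def intro: order_trans)
      also have "(\<integral>\<^sup>+ x. ennreal ((f x - f y)\<^sup>2 * p x) * indicator B x \<partial>lborel)
         \<le> (\<integral>\<^sup>+ x. ennreal M * (ennreal ((f y - f x)\<^sup>2) *
         (indicator B y * indicator B x * indicator (cball 0 (2 ^ k)) (y - x))) \<partial>lborel)"
      proof (intro nn_integral_mono)
        fix x :: 'a
        show "ennreal ((f x - f y)\<^sup>2 * p x) * indicator B x \<le> ennreal M * (ennreal ((f y - f x)\<^sup>2) *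
         (indicator B y * indicator B x * indicator (cball 0 (2 ^ k)) (y - x)))"
        proof (cases "x \<in> B")
          case x: True
          have "norm (y - x) \<le> 2 ^ k"
            using norm_triangle_ineq4[of y x] x True k by (simp add: B_def)
          moreover have "(f x - f y)\<^sup>2 * p x \<le> M * (f y - f x)\<^sup>2"
            using x M[of x] by (simp add: B_def mult_left_mono mult.commute[of M] power2_commute[of "f x"])
          ultimately show ?thesis
            using x True \<open>0 < M\<close> by (simp add: ennreal_leI flip: ennreal_mult)
        qed simp
      qed
      finally show ?thesis
        using True c \<open>0 < M\<close> by (simp add: nn_integral_cmult ennreal_mult distrib_left mult.assoc add_left_mono mult_left_mono)
    qed simp
    have "T * ennreal m = (\<integral>\<^sup>+ y. T * indicator B y \<partial>lborel)"
      by (simp add: nn_integral_cmult_indicator B)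
    also have "\<dots> \<le> (\<integral>\<^sup>+ y. ennreal c * J * indicator B y
       + ennreal (c * M) * (\<integral>\<^sup>+ x. ennreal ((f y - f x)\<^sup>2) *
         (indicator B y * indicator B x * indicator (cball 0 (2 ^ k)) (y - x)) \<partial>lborel) \<partial>lborel)"
      by (intro nn_integral_mono bound)
    also have "\<dots> = ennreal c * J * ennreal m + ennreal (c * M) * local_form f B (2 ^ k)"
      unfolding local_form_def
      by (subst nn_integral_add) (auto simp: nn_integral_cmult nn_integral_cmult_indicator B)
    also have "\<dots> \<le> ennreal c * J * ennreal m + ennreal (c * M) * (ennreal N * J)"
      by (intro add_left_mono mult_left_mono loc) simp
    also have "\<dots> = (ennreal (c * m) + ennreal (c * M * N)) * J"
      using c m \<open>0 < M\<close> N by (simp add: ennreal_mult distrib_left distrib_right mult_ac)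
    also have "\<dots> = ennreal C * J * ennreal m"
      using c m \<open>0 < M\<close> N C
      by (simp add: mult.assoc mult.commute[of J] flip: ennreal_plus)
        (simp add: C_def flip: mult.assoc ennreal_mult)
    finally show "T \<le> ennreal C * jump_energy 1 p f"
      using m by (simp add: J_def ennreal_mult_le_mult_iff mult.commute[of _ "ennreal m"])
  qed
qed

text \<open>The tail is bounded by \<open>outer_bound\<close> with \<open>\<sigma> = 2\<close>, the
  ball by \<open>local_nash\<close>. \<open>E\<close> stands for the energy and enters through the
  scaling of the jump forms: dividing \<open>\<epsilon> powr (d + \<alpha>)\<close> by a volume of
  order \<open>\<epsilon> powr d\<close> leaves \<open>\<epsilon> powr \<alpha>\<close> before
  \<open>E\<close> and \<open>\<epsilon> powr (- d)\<close> before \<open>I\<^sup>2\<close>.\<close>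

lemma super_poincare_split:
  fixes f p :: "'a::euclidean_space \<Rightarrow> real" and E :: ennreal and \<alpha> :: real
  defines "b \<equiv> unit_ball_vol (DIM('a))"
  assumes [measurable]: "f \<in> borel_measurable borel" "p \<in> borel_measurable borel"
    and p: "\<And>x. 0 \<le> p x"
    and R: "3/4 \<le> R"
    and t: "4 * 4 ^ DIM('a) \<le> t"
      "\<And>u v. R < norm v \<Longrightarrow> norm v - 1 \<le> norm u \<Longrightarrow> norm u \<le> norm v - 1/2 \<Longrightarrow> t * p v \<le> p u"
    and \<kappa>: "0 < \<kappa>" "\<And>x. norm x \<le> R + 1 \<Longrightarrow> \<kappa> \<le> p x"
    and M: "\<And>x. norm x \<le> R \<Longrightarrow> p x \<le> M"
    and \<epsilon>: "0 < \<epsilon>" "\<epsilon> \<le> 1"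
    and E: "\<And>\<epsilon>. 0 < \<epsilon> \<Longrightarrow> \<epsilon> \<le> 1 \<Longrightarrow> jump_energy \<epsilon> p f \<le> ennreal (2 * \<epsilon> powr (real DIM('a) + \<alpha>)) * E"
    and T: "(\<integral>\<^sup>+ x. ennreal ((f x)\<^sup>2 * p x) \<partial>lborel) = ennreal T" "0 \<le> T"
    and I: "(\<integral>\<^sup>+ x. ennreal (\<bar>f x\<bar> * p x) \<partial>lborel) = ennreal I" "0 \<le> I"
  shows "ennreal T \<le> ennreal (8 * 4 ^ DIM('a) / (t * b) + 4 * M / (b * \<kappa>) * \<epsilon> powr \<alpha>) * E
     + ennreal (4 * M / (b * \<kappa>\<^sup>2) * \<epsilon> powr (- real DIM('a)) * I\<^sup>2)"
proof -
  have b: "0 < b" by (simp add: b_def)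
  have M0: "0 < M" using \<kappa>(1) \<kappa>(2)[of 0] M[of 0] R by simp
  have t0: "0 < t" using t(1) by (rule less_le_trans[rotated]) simp
  define X where "X = (\<integral>\<^sup>+ x. ennreal ((f x)\<^sup>2 * p x) * indicator (- cball 0 R) x \<partial>lborel)"
  define Y where "Y = (\<integral>\<^sup>+ x. ennreal ((f x)\<^sup>2 * p x) * indicator (cball 0 R) x \<partial>lborel)"
  have XY: "ennreal T = X + Y"
    unfolding T(1)[symmetric] X_def Y_def
    by (subst nn_integral_add[symmetric]) (auto intro!: nn_integral_cong simp: indicator_def)
  show ?thesis
  proof (cases E)
    case top
    \<comment> \<open>For infinite \<open>E\<close> a positive coefficient suffices.\<close>
    have "0 < 8 * 4 ^ DIM('a) / (t * b) + 4 * M / (b * \<kappa>) * \<epsilon> powr \<alpha>"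
      using t0 b M0 \<kappa>(1) \<epsilon> by (intro add_pos_pos) auto
    then show ?thesis using top by (simp add: ennreal_mult_top)
  next
    case (real e)
    obtain x y where xy: "X = ennreal x" "Y = ennreal y" "0 \<le> x" "0 \<le> y"
      using XY by (cases X; cases Y) (auto simp: top_unique)
    have T': "T = x + y" using XY xy T(2) by (simp flip: ennreal_plus)
    have "ennreal ((1 - 1 / 2) * t * b / 4 ^ DIM('a)) * X \<le> jump_energy 1 p f + ennreal ((2 - 1) * b) * ennreal T"
      unfolding X_def T(1)[symmetric] b_def
      using outer_bound[of f p "- cball 0 R" t 2] p R t t0 by auto
    also have "\<dots> \<le> ennreal (2 * e) + ennreal ((2 - 1) * b) * ennreal T"
      using E[of 1] real by (intro add_right_mono) (simp add: ennreal_mult)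
    finally have "(1 - 1 / 2) * t * b / 4 ^ DIM('a) * x \<le> 2 * e + (2 - 1) * b * T"
      using real b T t0 xy by (simp flip: ennreal_plus ennreal_mult)
    then have "x \<le> (2 * e + b * T) * (2 * 4 ^ DIM('a)) / (t * b)"
      using t0 b by (simp add: field_simps)
    also have "\<dots> = 4 * 4 ^ DIM('a) / (t * b) * e + (2 * 4 ^ DIM('a) / t) * T"
      using t0 b by (simp add: field_simps)
    \<comment> \<open>The lower bound on \<open>t\<close> is chosen for this: at most half of
      \<open>T\<close> returns on the right and can be absorbed.\<close>
    also have "(2 * 4 ^ DIM('a) / t) * T \<le> (1/2) * T"
      using t0 t(1) T(2) by (intro mult_right_mono) (simp_all add: field_simps)
    finally have *: "x \<le> 4 * 4 ^ DIM('a) / (t * b) * e + (1/2) * T" by simp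
    have x: "x + y \<le> 8 * 4 ^ DIM('a) / (t * b) * e + 2 * y"
    proof -
      have "8 * 4 ^ DIM('a) / (t * b) * e = 2 * (4 * 4 ^ DIM('a) / (t * b) * e)" by simp
      then show ?thesis using * T' by linarith
    qed
    have ed: "\<epsilon> ^ DIM('a) = \<epsilon> powr DIM('a)" using \<epsilon>(1) by (simp add: powr_realpow)
    have "ennreal (b * \<epsilon> ^ DIM('a)) * Y \<le> ennreal (M / \<kappa>) * jump_energy \<epsilon> p f
           + ennreal (2 * M / \<kappa>\<^sup>2) * (ennreal I)\<^sup>2"
      unfolding Y_def I(1)[symmetric] b_def
      by (rule local_nash) (use p \<epsilon> \<kappa> M M0 in auto)
    also have "\<dots> \<le> ennreal (M / \<kappa>) * (ennreal (2 * \<epsilon> powr (real DIM('a) + \<alpha>)) * ennreal e)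
           + ennreal (2 * M / \<kappa>\<^sup>2) * (ennreal I)\<^sup>2"
      using E[of \<epsilon>] real \<epsilon> by (intro add_right_mono mult_left_mono) auto
    finally have "b * \<epsilon> ^ DIM('a) * y \<le> M / \<kappa> * (2 * \<epsilon> powr (real DIM('a) + \<alpha>) * e) + 2 * M / \<kappa>\<^sup>2 * I\<^sup>2"
      using xy real \<epsilon> b M0 \<kappa>(1) I by (simp add: ennreal_power flip: ennreal_plus ennreal_mult)
    then have "y \<le> (M / \<kappa> * (2 * \<epsilon> powr (real DIM('a) + \<alpha>) * e) + 2 * M / \<kappa>\<^sup>2 * I\<^sup>2) / (b * \<epsilon> powr DIM('a))"
      using b \<epsilon> by (simp add: ed field_simps)
    also have "\<dots> = 2 * M / (b * \<kappa>) * \<epsilon> powr \<alpha> * e + 2 * M / (b * \<kappa>\<^sup>2) * \<epsilon> powr (- real DIM('a)) * I\<^sup>2"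
      using b \<epsilon> \<kappa>(1) by (simp add: powr_add powr_minus field_simps power2_eq_square)
    finally have y: "y \<le> 2 * M / (b * \<kappa>) * \<epsilon> powr \<alpha> * e + 2 * M / (b * \<kappa>\<^sup>2) * \<epsilon> powr (- real DIM('a)) * I\<^sup>2" .
    have "T \<le> (8 * 4 ^ DIM('a) / (t * b) + 4 * M / (b * \<kappa>) * \<epsilon> powr \<alpha>) * e
       + 4 * M / (b * \<kappa>\<^sup>2) * \<epsilon> powr (- real DIM('a)) * I\<^sup>2"
    proof -
      define u v w where "u = 8 * 4 ^ DIM('a) / (t * b)" and "v = 2 * M / (b * \<kappa>) * \<epsilon> powr \<alpha>"
        and "w = 2 * M / (b * \<kappa>\<^sup>2) * \<epsilon> powr (- real DIM('a)) * I\<^sup>2"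
      have "T \<le> (u + 2 * v) * e + 2 * w"
        using x y unfolding T' u_def[symmetric] v_def[symmetric] w_def[symmetric] by (simp add: algebra_simps)
      then show ?thesis by (simp add: u_def v_def w_def mult.assoc)
    qed
    then show ?thesis
      using real t0 b M0 \<kappa>(1) by (simp flip: ennreal_plus ennreal_mult add: ennreal_leI)
  qed
qed

section \<open>The potential and its measure\<close>

lemma Cb_infty_measurable: "f \<in> Cb_infty \<Longrightarrow> f \<in> borel_measurable borel"
  unfolding Cb_infty_def
  by (auto dest!: spec[of _ "[]"] intro!: borel_measurable_continuous_onI continuous_at_imp_continuous_on
      differentiable_imp_continuous_within)

lemma Cb_infty_bounded: "f \<in> Cb_infty \<Longrightarrow> bounded (range f)"
  unfolding Cb_infty_def by (auto dest!: spec[of _ "[]"])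

lemma exp_potential_bounds:
  fixes V :: "real^'n::finite \<Rightarrow> real"
  assumes "locally_bounded V"
  obtains C where "\<And>x. norm x \<le> r \<Longrightarrow> exp (- C) \<le> exp (- V x)"
    "\<And>x. norm x \<le> r \<Longrightarrow> exp (- V x) \<le> exp C"
proof -
  have "bounded (V ` cball 0 r)"
    using assms by (simp add: locally_bounded_def)
  then obtain C where "\<forall>x\<in>cball 0 r. \<bar>V x\<bar> \<le> C"
    unfolding bounded_iff by auto
  then have C: "\<bar>V x\<bar> \<le> C" if "norm x \<le> r" for x using that by simp
  show thesis
    by (rule that[of C]) (use C in \<open>force simp: abs_le_iff\<close>)+
qed

text \<open>A real supremum bounds its members only if the set is bounded above; local boundedness
  ensures this.\<close>

lemma le_K_fun:
  assumes "locally_bounded V" "norm x \<le> r"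
  shows "exp (- V x) \<le> K_fun V r"
proof -
  obtain C where "\<And>x. norm x \<le> r \<Longrightarrow> exp (- V x) \<le> exp C"
    using exp_potential_bounds[OF assms(1), of r] by blast
  then show ?thesis unfolding K_fun_def using assms(2)
    by (intro cSUP_upper) (auto intro!: bdd_aboveI2[of _ _ "exp C"])
qed

lemma k_fun_le:
  assumes "norm x \<le> r + 1"
  shows "k_fun V r \<le> exp (- V x)"
  unfolding k_fun_def using assms by (intro cINF_lower) (auto intro!: bdd_belowI2[of _ 0])

lemma k_fun_pos:
  fixes V :: "real^'n::finite \<Rightarrow> real"
  assumes "locally_bounded V" "0 \<le> r"
  shows "0 < k_fun V r"
proof -
  obtain C where C: "\<And>x. norm x \<le> r + 1 \<Longrightarrow> exp (- C) \<le> exp (- V x)"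
    using exp_potential_bounds[OF assms(1), of "r + 1"] by blast
  \<comment> \<open>A real infimum over the empty set would be unspecified, so a member is
    named.\<close>
  have "(0::real^'n) \<in> {x. norm x \<le> r + 1}" using assms(2) by simp
  then have "{x::real^'n. norm x \<le> r + 1} \<noteq> {}" by blast
  then have "exp (- C) \<le> k_fun V r"
    unfolding k_fun_def using C by (intro cINF_greatest) auto
  then show ?thesis by (rule less_le_trans[rotated]) simp
qed

section \<open>Decay of the weight across shells\<close>

text \<open>Turns bounds on the quantity inside \<open>Phi\<close> into the pointwise comparison
  between \<open>v\<close> and its inner shell that \<open>outer_bound\<close> assumes.\<close>

lemma shell_decay:
  assumes "ennreal \<theta> \<le> ennreal (exp (V v)) * inner_inf V v" "0 \<le> \<theta>"
    and "norm v - 1 \<le> norm u" "norm u \<le> norm v - 1/2"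
  shows "\<theta> * exp (- V v) \<le> exp (- V u)"
proof -
  have "inner_inf V v \<le> ennreal (exp (- V u))"
    unfolding inner_inf_def using assms(3,4) by (intro INF_lower) auto
  then have "ennreal \<theta> \<le> ennreal (exp (V v)) * ennreal (exp (- V u))"
    using assms(1) by (meson mult_left_mono order_trans zero_le)
  then have "\<theta> \<le> exp (V v) * exp (- V u)"
    by (simp flip: ennreal_mult)
  then show ?thesis by (simp add: exp_minus field_simps)
qed

text \<open>The supremum in \<open>outer_sup\<close> includes \<open>v\<close> itself, hence is at
  least \<open>exp (- V v)\<close>. Lower bounds on the ratio thus pass to the quantity inside
  \<open>Phi\<close>.\<close>

lemma ratio_le:
  "inner_inf V v / outer_sup V v \<le> ennreal (exp (V v)) * inner_inf V v"
proof -
  have le: "ennreal (exp (- V v)) \<le> outer_sup V v"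
    unfolding outer_sup_def by (intro SUP_upper) auto
  have "inverse (outer_sup V v) \<le> ennreal (exp (V v))"
  proof (cases "outer_sup V v")
    case (real r)
    then have r: "exp (- V v) \<le> r" using le by simp
    then have "0 < r" by (rule less_le_trans[rotated]) simp
    moreover have "inverse r \<le> inverse (exp (- V v))" using r by (intro le_imp_inverse_le) auto
    ultimately show ?thesis using real by (simp add: inverse_ennreal exp_minus ennreal_leI)
  \<comment> \<open>An infinite supremum has inverse 0.\<close>
  qed simp
  then show ?thesis
    by (simp add: divide_ennreal_def mult.commute mult_left_mono)
qed

text \<open>Strictness leaves room for a \<open>\<theta>\<close> above \<open>t\<close>, which the
  absorption in \<open>lyapunov_bound\<close> relies on; \<open>r\<close> lets the caller demand a
  large radius.\<close>

lemma liminf_ratio_gt: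
  assumes "ennreal t < liminf_ratio V"
  obtains R \<theta> where "t < \<theta>" "r \<le> R"
    "\<And>v. R \<le> norm v \<Longrightarrow> ennreal \<theta> \<le> ennreal (exp (V v)) * inner_inf V v"
proof -
  \<comment> \<open>The intermediate \<open>z\<close> is finite even if the limit inferior is
    infinite.\<close>
  obtain z where z: "ennreal t < z" "z < liminf_ratio V" using dense[OF assms] by blast
  then obtain \<theta> where \<theta>: "z = ennreal \<theta>" "0 \<le> \<theta>" by (cases z) (auto simp: top.not_eq_extremum)
  have "\<forall>\<^sub>F v in at_infinity. ennreal \<theta> < inner_inf V v / outer_sup V v"
    using z(2) unfolding \<theta> liminf_ratio_def by (rule less_LiminfD)
  then obtain b where b: "\<And>v. b \<le> norm v \<Longrightarrow> ennreal \<theta> < inner_inf V v / outer_sup V v"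
    unfolding eventually_at_infinity by blast
  show thesis
  proof (rule that[of \<theta> "max b r"])
    show "t < \<theta>" using z(1) \<theta> by (metis ennreal_leI leD not_le_imp_less)
    show "ennreal \<theta> \<le> ennreal (exp (V v)) * inner_inf V v" if "max b r \<le> norm v" for v
      using b[of v] ratio_le[of V v] that by (simp add: less_imp_le order_trans)
  qed simp
qed

section \<open>The function \<open>Phi\<close> and its inverse\<close>

lemma Phi_mono: "r \<le> r' \<Longrightarrow> Phi V r \<le> Phi V r'"
  unfolding Phi_def by (intro INF_superset_mono) auto

text \<open>On the unit sphere the inner shell contains 0, so \<open>exp (V v - V 0)\<close> is an
  upper bound.\<close>

lemma Phi_finite: "Phi (V :: real^'n::finite \<Rightarrow> real) 1 < \<infinity>"
proof -
  obtain v :: "real^'n" where v: "norm v = 1" using vector_choose_size[of 1] by auto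
  have "Phi V 1 \<le> ennreal (exp (V v)) * inner_inf V v"
    unfolding Phi_def using v by (intro INF_lower) auto
  also have "\<dots> \<le> ennreal (exp (V v)) * ennreal (exp (- V 0))"
    unfolding inner_inf_def using v by (intro mult_left_mono INF_lower) auto
  also have "\<dots> < \<infinity>" by (simp add: ennreal_mult_less_top)
  finally show ?thesis .
qed

text \<open>\<open>Phi\<close> reaches every real level, so the \<open>Inf\<close> in
  \<open>Phi_inv\<close> is that of a nonempty set.\<close>

lemma Phi_inv_set_nonempty:
  assumes "liminf_ratio V = \<infinity>"
  shows "{r. 1/2 \<le> r \<and> ennreal t \<le> Phi V r} \<noteq> {}"
proof -
  have "ennreal t < liminf_ratio V" using assms by simp
  then obtain \<theta> R where "t < \<theta>" "1/2 \<le> R"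
    "\<And>v. R \<le> norm v \<Longrightarrow> ennreal \<theta> \<le> ennreal (exp (V v)) * inner_inf V v"
    by (rule liminf_ratio_gt[where r = "1/2"]) blast
  then have "ennreal t \<le> Phi V R"
    unfolding Phi_def by (intro INF_greatest) (auto intro: order_trans[OF ennreal_leI[OF less_imp_le]])
  then show ?thesis using \<open>1/2 \<le> R\<close> by blast
qed

lemma Phi_inv_ge:
  assumes "liminf_ratio V = \<infinity>" "\<And>r. 1/2 \<le> r \<Longrightarrow> ennreal t \<le> Phi V r \<Longrightarrow> a \<le> r"
  shows "a \<le> Phi_inv V t"
  unfolding Phi_inv_def using Phi_inv_set_nonempty[OF assms(1)] assms(2)
  by (intro cInf_greatest) auto

text \<open>The infimum may fail to be attained, but a point strictly beyond it lies beyond some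
  member of the set. This gives the strict form \<open>R < norm v\<close> of the decay
  hypotheses.\<close>

lemma Phi_inv_less:
  assumes "liminf_ratio V = \<infinity>" "Phi_inv V t < norm v"
  shows "ennreal t \<le> ennreal (exp (V v)) * inner_inf V v"
proof -
  obtain r where r: "ennreal t \<le> Phi V r" "r < norm v"
    using cInf_lessD[OF Phi_inv_set_nonempty[OF assms(1)] assms(2)[unfolded Phi_inv_def]] by auto
  note r(1)
  also have "Phi V r \<le> ennreal (exp (V v)) * inner_inf V v"
    unfolding Phi_def using r(2) by (intro INF_lower) auto
  finally show ?thesis .
qed

section \<open>Lower bound for the rate function\<close>

lemma beta_mult: "beta \<alpha> V C C3 s = C * beta \<alpha> V 1 C3 s"
  by (simp add: beta_def Let_def)

text \<open>The bound is positive and free of \<open>s\<close> and \<open>C3\<close>. As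
  \<open>exp (- V 0)\<close> lies between \<open>k_fun V R\<close> and \<open>K_fun V R\<close>,
  lowering \<open>K_fun\<close> to \<open>k_fun\<close> leaves \<open>1 / k_fun V R\<close>, and
  \<open>R\<close> is at least 1/2 by definition of \<open>Phi_inv\<close>.\<close>

lemma beta_ge:
  fixes V :: "real^'n::finite \<Rightarrow> real"
  assumes "locally_bounded V" "0 < \<alpha>" "liminf_ratio V = \<infinity>"
  defines "d \<equiv> real CARD('n)"
  shows "(1/2) powr (d + d\<^sup>2 / \<alpha>) / exp (- V 0) \<le> beta \<alpha> V 1 C3 s"
proof -
  define R where "R = Phi_inv V (C3 * inverse s)"
  have R: "1/2 \<le> R" unfolding R_def by (rule Phi_inv_ge[OF assms(3)])
  define w where "w = exp (- V 0)"
  have w: "w \<le> K_fun V R" "k_fun V R \<le> w" "0 < k_fun V R"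
    unfolding w_def using R assms(1) by (auto intro!: le_K_fun k_fun_le k_fun_pos)
  define e where "e = 1 + d / \<alpha>"
  have e: "0 \<le> e" using assms(2) by (simp add: e_def d_def)
  have "1 / w \<le> 1 / k_fun V R" using w by (intro divide_left_mono) auto
  also have "\<dots> = k_fun V R powr e * k_fun V R powr (- 1 - e)"
    using w by (simp add: powr_minus_divide flip: powr_add)
  also have "\<dots> \<le> K_fun V R powr e * k_fun V R powr (- 1 - e)"
    using w e by (intro mult_right_mono powr_mono2) auto
  finally have 1: "1 / w \<le> K_fun V R powr e * k_fun V R powr (- 1 - e)" .
  have "(1/2) powr (d + d\<^sup>2 / \<alpha>) * (1 / w)
      \<le> ((1 + s powr (- d / \<alpha>)) * R powr (d + d\<^sup>2 / \<alpha>)) * (K_fun V R powr e * k_fun V R powr (- 1 - e))"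
  proof (intro mult_mono 1)
    have "1 * (1/2) powr (d + d\<^sup>2 / \<alpha>) \<le> (1 + s powr (- d / \<alpha>)) * R powr (d + d\<^sup>2 / \<alpha>)"
      using R assms(2) by (intro mult_mono powr_mono2) (auto simp: d_def)
    then show "(1/2) powr (d + d\<^sup>2 / \<alpha>) \<le> (1 + s powr (- d / \<alpha>)) * R powr (d + d\<^sup>2 / \<alpha>)" by simp
  qed (use w in \<open>auto simp: w_def\<close>)
  then show ?thesis
    unfolding beta_def Let_def R_def[symmetric] d_def[symmetric] w_def[symmetric]
    by (simp add: e_def mult.assoc)
qed

section \<open>The probability measure and its energy\<close>

context
  fixes V :: "real^'n::finite \<Rightarrow> real"
  assumes V [measurable]: "V \<in> borel_measurable borel"
    and integrable_exp: "integrable lborel (\<lambda>x. exp (- V x))"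
begin

text \<open>A vanishing integral would make the positive function \<open>exp (- V x)\<close> zero
  almost everywhere, hence Lebesgue measure trivial.\<close>

lemma C_norm_pos: "0 < C_norm V"
proof -
  have "(LINT x|lborel. exp (- V x)) \<noteq> 0"
  proof
    assume "(LINT x|lborel. exp (- V x)) = 0"
    then have "AE x in lborel. exp (- V x) = 0"
      using integrable_exp by (subst (asm) integral_nonneg_eq_0_iff_AE) auto
    then have "AE x::real^'n in lborel. False" by simp
    then have "ae_filter (lborel :: (real^'n) measure) = bot"
      by (simp add: trivial_limit_def)
    then show False unfolding ae_filter_eq_bot_iff by simp
  qed
  moreover have "0 \<le> (LINT x|lborel. exp (- V x))" by simp
  ultimately have "0 < (LINT x|lborel. exp (- V x))" by linarith
  then show ?thesis by (simp add: C_norm_def)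
qed

lemma nn_integral_mu:
  assumes [measurable]: "g \<in> borel_measurable borel"
  shows "(\<integral>\<^sup>+ x. g x \<partial>mu V) = (\<integral>\<^sup>+ x. g x * ennreal (C_norm V * exp (- V x)) \<partial>lborel)"
  unfolding mu_def by (subst nn_integral_density) (auto simp: mult.commute)

lemma sets_mu [measurable_cong]: "sets (mu V) = sets borel"
  by (simp add: mu_def)

lemma emeasure_mu_UNIV: "emeasure (mu V) UNIV = 1"
proof -
  have "emeasure (mu V) UNIV = (\<integral>\<^sup>+ x. ennreal (C_norm V * exp (- V x)) \<partial>lborel)"
    unfolding mu_def by (subst emeasure_density) auto
  also have "\<dots> = ennreal (LINT x|lborel. C_norm V * exp (- V x))"
    using C_norm_pos by (intro nn_integral_eq_integral integrable_mult_right integrable_exp) auto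
  also have "(LINT x|lborel. C_norm V * exp (- V x)) = 1"
    using C_norm_pos by (simp add: C_norm_def)
  finally show ?thesis by simp
qed

lemma finite_measure_mu: "finite_measure (mu V)"
  by (rule finite_measureI) (simp add: mu_def emeasure_mu_UNIV[unfolded mu_def])

lemma measure_mu_UNIV: "measure (mu V) UNIV = 1"
  by (simp add: measure_def emeasure_mu_UNIV)

lemma integrable_mu_bounded:
  assumes "g \<in> borel_measurable borel" "bounded (range g)"
  shows "integrable (mu V) (g :: _ \<Rightarrow> real)"
proof -
  obtain B where "\<And>x. norm (g x) \<le> B" using assms(2) unfolding bounded_iff by auto
  then show ?thesis using assms(1)
    by (intro finite_measure.integrable_const_bound[OF finite_measure_mu, of _ B])
       (auto simp: measurable_cong_sets[OF sets_mu refl])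
qed

text \<open>Passes from the weighted Lebesgue integrals of the Euclidean estimates to the real
  integrals against \<open>mu V\<close>.\<close>

lemma nn_integral_density_bounded:
  assumes [measurable]: "g \<in> borel_measurable borel" and "bounded (range g)" "\<And>x. 0 \<le> g x"
  shows "(\<integral>\<^sup>+ x. ennreal (g x * (C_norm V * exp (- V x))) \<partial>lborel) = ennreal (LINT x|mu V. g x)"
proof -
  have "(\<integral>\<^sup>+ x. ennreal (g x * (C_norm V * exp (- V x))) \<partial>lborel) = (\<integral>\<^sup>+ x. ennreal (g x) \<partial>mu V)"
    using assms(3) C_norm_pos by (simp add: nn_integral_mu ennreal_mult)
  also have "\<dots> = ennreal (LINT x|mu V. g x)"
    using assms by (intro nn_integral_eq_integral integrable_mu_bounded) auto
  finally show ?thesis .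
qed

text \<open>For \<open>norm (x - y) \<le> \<epsilon>\<close> the factor
  \<open>\<epsilon> powr a / norm (x - y) powr a\<close> is at least 1, and
  \<open>\<epsilon> \<le> 1\<close> keeps such jumps within the range of \<open>energy\<close>. The
  2 cancels the 1/2 in \<open>energy\<close>.\<close>

lemma jump_energy_le_energy:
  fixes \<alpha> :: real
  assumes [measurable]: "f \<in> borel_measurable borel" and \<epsilon>: "0 < \<epsilon>" "\<epsilon> \<le> 1" and "0 \<le> \<alpha>"
  shows "jump_energy \<epsilon> (\<lambda>x. C_norm V * exp (- V x)) f
    \<le> ennreal (2 * \<epsilon> powr (real DIM(real^'n) + \<alpha>)) * energy \<alpha> V f"
proof -
  define a where "a = real CARD('n) + \<alpha>"
  have a: "0 \<le> a" using assms(4) by (simp add: a_def)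
  define p where "p x = C_norm V * exp (- V x)" for x
  have [measurable]: "p \<in> borel_measurable borel" unfolding p_def by measurable
  have p: "0 \<le> p x" for x using C_norm_pos by (simp add: p_def)
  define k where "k x y = ennreal ((f x - f y)\<^sup>2 / norm (x - y) powr a)
                     * indicator {y. norm (x - y) \<le> 1} y" for x y
  have k_eq: "k x y = ennreal ((f x - f y)\<^sup>2 / norm (x - y) powr a) * indicator (cball 0 1) (x - y)" for x y
    by (simp add: k_def indicator_def)
  have [measurable]: "case_prod k \<in> borel_measurable (borel \<Otimes>\<^sub>M borel)"
    "case_prod k \<in> borel_measurable (borel \<Otimes>\<^sub>M lborel)"
    unfolding k_eq[abs_def] by measurable
  have *: "ennreal (p x * (f x - f y)\<^sup>2) * indicator (cball 0 \<epsilon>) (x - y)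
      \<le> ennreal (\<epsilon> powr a) * (k x y * ennreal (p x))" for x y
  proof (cases "norm (x - y) \<le> \<epsilon>")
    case True
    have "p x * (f x - f y)\<^sup>2 \<le> \<epsilon> powr a * ((f x - f y)\<^sup>2 / norm (x - y) powr a * p x)"
    \<comment> \<open>On the diagonal both sides vanish.\<close>
    proof (cases "x = y")
      case False
      then have "1 \<le> \<epsilon> powr a / norm (x - y) powr a"
        using powr_mono2[OF a _ True] by simp
      then have "(p x * (f x - f y)\<^sup>2) * 1 \<le> (p x * (f x - f y)\<^sup>2) * (\<epsilon> powr a / norm (x - y) powr a)"
        using p[of x] by (intro mult_left_mono) auto
      then show ?thesis by (simp add: mult_ac)
    qed simp
    then show ?thesis using True \<epsilon> p by (simp add: k_eq ennreal_leI flip: ennreal_mult)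
  qed auto
  have "jump_energy \<epsilon> p f \<le> (\<integral>\<^sup>+ x. (\<integral>\<^sup>+ y. ennreal (\<epsilon> powr a) * (k x y * ennreal (p x)) \<partial>lborel) \<partial>lborel)"
    unfolding jump_energy_def by (intro nn_integral_mono *)
  also have "\<dots> = ennreal (\<epsilon> powr a) * (\<integral>\<^sup>+ x. (\<integral>\<^sup>+ y. k x y \<partial>lborel) * ennreal (p x) \<partial>lborel)"
    by (simp add: nn_integral_cmult nn_integral_multc)
  also have "(\<integral>\<^sup>+ x. (\<integral>\<^sup>+ y. k x y \<partial>lborel) * ennreal (p x) \<partial>lborel) = (\<integral>\<^sup>+ x. (\<integral>\<^sup>+ y. k x y \<partial>lborel) \<partial>mu V)"
    unfolding p_def by (rule nn_integral_mu[symmetric]) measurable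
  also have "ennreal (\<epsilon> powr a) * \<dots> = ennreal (2 * \<epsilon> powr a) * energy \<alpha> V f"
  proof -
    have "ennreal (2 * \<epsilon> powr a) * ennreal (1/2) = ennreal (\<epsilon> powr a)"
      by (simp flip: ennreal_mult del: ennreal_half)
    then show ?thesis
      unfolding energy_def a_def[symmetric] k_def[symmetric] by (metis mult.assoc)
  qed
  finally show ?thesis by (simp add: p_def[abs_def] a_def)
qed

end

section \<open>Poincare and super Poincare inequalities\<close>

text \<open>By convexity of the exponential, \<open>(2 powr \<alpha> - 1) / \<alpha>\<close> is at
  least \<open>ln 2\<close>, hence at least 1/2, which the odd factor 2 in
  \<open>2 ^ (2 * d + 1)\<close> makes up for. The hypothesis of the first part therefore puts the
  ratio above \<open>4 ^ d\<close>.\<close>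

lemma poincare_threshold:
  assumes "0 < \<alpha>"
  shows "4 ^ d \<le> 1 / \<alpha> * 2 ^ (2 * d + 1) * (exp 1 + exp (1/2)) * (2 powr \<alpha> - 1 :: real)"
proof -
  have "1 + \<alpha> * ln 2 \<le> exp (\<alpha> * ln 2)" by (rule exp_ge_add_one_self)
  then have "\<alpha> * ln 2 \<le> 2 powr \<alpha> - 1" by (simp add: powr_def algebra_simps)
  moreover have "\<alpha> * (1/2) \<le> \<alpha> * ln 2"
    using assms ln2_ge_two_thirds by (intro mult_left_mono) auto
  ultimately have "1/2 * \<alpha> \<le> 2 powr \<alpha> - 1" by linarith
  then have 1: "1/2 \<le> (2 powr \<alpha> - 1) / \<alpha>" using assms by (simp add: pos_le_divide_eq)
  have 2: "1 \<le> exp 1 + exp (1/2 :: real)" using exp_ge_add_one_self[of 1] exp_gt_zero[of "1/2::real"] by linarith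
  have "(4::real) ^ d * 1 * (2 * (1/2)) \<le> 4 ^ d * (exp 1 + exp (1/2)) * (2 * ((2 powr \<alpha> - 1) / \<alpha>))"
    using 1 2 by (intro mult_mono) auto
  also have "\<dots> = 1 / \<alpha> * (2 * 4 ^ d) * (exp 1 + exp (1/2)) * (2 powr \<alpha> - 1)"
    by (simp only: times_divide_eq_left times_divide_eq_right mult_1_left mult_ac)
  also have "2 * 4 ^ d = (2::real) ^ (2 * d + 1)" by (simp add: power_mult)
  finally show ?thesis by simp
qed

context
  fixes V :: "real^'n::finite \<Rightarrow> real" and \<alpha> :: real
  assumes \<alpha>: "0 < \<alpha>"
    and V [measurable]: "V \<in> borel_measurable borel"
    and loc: "locally_bounded V"
    and integrable_exp: "integrable lborel (\<lambda>x. exp (- V x))"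
begin

lemma scaled_bounds:
  "norm x \<le> r \<Longrightarrow> C_norm V * exp (- V x) \<le> C_norm V * K_fun V r"
  "norm x \<le> r + 1 \<Longrightarrow> C_norm V * k_fun V r \<le> C_norm V * exp (- V x)"
  using C_norm_pos[OF V integrable_exp] le_K_fun[OF loc, of x r] k_fun_le[of x r V] by auto

text \<open>For mean zero the second moment of \<open>f - a\<close> is that of \<open>f\<close> plus
  \<open>a\<^sup>2\<close>, so the second moment of \<open>f\<close> is an admissible
  \<open>T\<close> in \<open>variance_le_jump_energy\<close>.\<close>

lemma poincare:
  assumes lim: "ennreal (4 ^ CARD('n)) < liminf_ratio V"
  shows "\<exists>C1>0. \<forall>f\<in>Cb_infty. (LINT x|mu V. f x) = 0 \<longrightarrow>
           ennreal (LINT x|mu V. (f x)\<^sup>2) \<le> ennreal C1 * energy \<alpha> V f"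
proof -
  obtain \<theta> R where \<theta>: "4 ^ CARD('n) < \<theta>" "3/4 \<le> R"
    "\<And>v. R \<le> norm v \<Longrightarrow> ennreal \<theta> \<le> ennreal (exp (V v)) * inner_inf V v"
    using liminf_ratio_gt[OF lim, of "3/4"] by blast
  have "0 < \<theta>" using \<theta>(1) by (rule less_trans[rotated]) simp
  define p where "p x = C_norm V * exp (- V x)" for x
  note C = C_norm_pos[OF V integrable_exp]
  have p [measurable]: "p \<in> borel_measurable borel" unfolding p_def by measurable
  have p0: "0 \<le> p x" for x using C by (simp add: p_def)
  have decay: "\<theta> * p v \<le> p u" if "R < norm v" "norm v - 1 \<le> norm u" "norm u \<le> norm v - 1/2" for u v
    using shell_decay[OF \<theta>(3), of v u] that \<open>0 < \<theta>\<close> C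
    by (simp add: p_def mult.left_commute)
  obtain c where c: "0 < c"
    "\<And>f T. f \<in> borel_measurable borel \<Longrightarrow> 
      (\<And>a. (\<integral>\<^sup>+ x. ennreal ((f x - a)\<^sup>2 * p x) \<partial>lborel) < \<infinity>) \<Longrightarrow>
      (\<And>a. T \<le> (\<integral>\<^sup>+ x. ennreal ((f x - a)\<^sup>2 * p x) \<partial>lborel)) \<Longrightarrow>
      T \<le> ennreal c * jump_energy 1 p f"
  proof (rule variance_le_jump_energy[of p R \<theta> "C_norm V * k_fun V R" "C_norm V * K_fun V R"])
    show "0 < C_norm V * k_fun V R" using C k_fun_pos[OF loc, of R] \<theta>(2) by simp
  qed (use p p0 \<theta>(1,2) decay scaled_bounds in \<open>auto simp: p_def\<close>)
  have "ennreal (LINT x|mu V. (f x)\<^sup>2) \<le> ennreal (2 * c) * energy \<alpha> V f"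
    if f: "f \<in> Cb_infty" and mean: "(LINT x|mu V. f x) = 0" for f
  proof -
    note [measurable] = Cb_infty_measurable[OF f]
    have bd: "bounded (range (\<lambda>x. (f x - a)\<^sup>2))" for a
    proof -
      obtain B where B: "\<And>x. \<bar>f x\<bar> \<le> B" using Cb_infty_bounded[OF f] unfolding bounded_iff by auto
      have "\<bar>f x - a\<bar> \<le> B + \<bar>a\<bar>" for x using B[of x] by linarith
      then have "norm ((f x - a)\<^sup>2) \<le> (B + \<bar>a\<bar>)\<^sup>2" for x
        using power_mono[of "\<bar>f x - a\<bar>" "B + \<bar>a\<bar>" 2] by simp
      then show ?thesis unfolding bounded_iff by blast
    qed
    have eq: "(\<integral>\<^sup>+ x. ennreal ((f x - a)\<^sup>2 * p x) \<partial>lborel) = ennreal (LINT x|mu V. (f x - a)\<^sup>2)" for a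
      unfolding p_def by (rule nn_integral_density_bounded[OF V integrable_exp _ bd]) auto
    have int: "integrable (mu V) f" "integrable (mu V) (\<lambda>x. (f x)\<^sup>2)"
      "integrable (mu V) (\<lambda>x. a)" for a :: real
      using bd[of 0] Cb_infty_bounded[OF f]
      by (auto intro!: integrable_mu_bounded[OF V integrable_exp] simp: image_constant_conv)
    have "(LINT x|mu V. (f x - a)\<^sup>2) = (LINT x|mu V. (f x)\<^sup>2) + a\<^sup>2" for a
    proof -
      have "(LINT x|mu V. (f x - a)\<^sup>2) = (LINT x|mu V. (f x)\<^sup>2 - 2 * a * f x + a\<^sup>2)"
        by (simp add: power2_diff algebra_simps)
      also have "\<dots> = (LINT x|mu V. (f x)\<^sup>2) - 2 * a * (LINT x|mu V. f x) + a\<^sup>2"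
        using int measure_mu_UNIV[OF V integrable_exp] by (simp add: mu_def)
      finally show ?thesis by (simp add: mean)
    qed
    then have "ennreal (LINT x|mu V. (f x)\<^sup>2) \<le> ennreal c * jump_energy 1 p f"
      by (intro c(2)) (auto simp: eq intro!: ennreal_leI)
    also have "\<dots> \<le> ennreal c * (ennreal 2 * energy \<alpha> V f)"
      using jump_energy_le_energy[OF V integrable_exp, of f 1 \<alpha>] \<alpha>
      by (intro mult_left_mono) (auto simp: p_def[abs_def])
    also have "\<dots> = ennreal (2 * c) * energy \<alpha> V f"
      using c(1) by (simp add: ennreal_mult mult_ac)
    finally show ?thesis .
  qed
  then show ?thesis using c(1) by (intro exI[of _ "2 * c"]) auto
qed

section \<open>The super Poincare inequality\<close>

text \<open>For small \<open>s\<close> the radius \<open>R = Phi_inv V (D / s)\<close> makes the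
  tail cost \<open>s / 2\<close>, and \<open>\<epsilon>\<close> is then taken so small that the ball
  costs at most \<open>s / 2\<close>. What remains before the \<open>L^1\<close> term is at most a
  multiple of \<open>beta\<close>.\<close>

lemma super_poincare:
  assumes lim: "liminf_ratio V = \<infinity>"
  shows "\<exists>C2>0. \<exists>C3>0. \<forall>s>0. \<forall>f\<in>Cb_infty.
          ennreal (LINT x|mu V. (f x)\<^sup>2)
            \<le> ennreal s * energy \<alpha> V f
              + ennreal (beta \<alpha> V C2 C3 s * (LINT x|mu V. \<bar>f x\<bar>)\<^sup>2)"
proof -
  define d where "d = real CARD('n)"
  define b where "b = unit_ball_vol d"
  have b: "0 < b" by (simp add: b_def d_def)
  have d: "0 \<le> d" by (simp add: d_def)
  define p where "p x = C_norm V * exp (- V x)" for x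
  define Z where "Z = C_norm V"
  have Z: "0 < Z" unfolding Z_def by (rule C_norm_pos[OF V integrable_exp])
  have p [measurable]: "p \<in> borel_measurable borel" unfolding p_def by measurable
  have p0: "0 \<le> p x" for x using Z by (simp add: p_def Z_def)
  \<comment> \<open>With \<open>t = D / s\<close> the tail coefficient
    \<open>8 * 4 ^ d / (t * b)\<close> is exactly \<open>s / 2\<close>. \<open>D\<close> becomes
    \<open>C3\<close>.\<close>
  define D where "D = 16 * 4 ^ CARD('n) / b"
  have D: "0 < D" using b by (simp add: D_def)
  obtain \<phi> where \<phi>: "Phi V 1 = ennreal \<phi>" "0 \<le> \<phi>"
    using Phi_finite[of V] by (cases "Phi V 1") auto
  \<comment> \<open>For \<open>s \<le> s0\<close> the first entry forces \<open>\<phi> < t\<close>,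
    the second \<open>4 * 4 ^ d \<le> t\<close>.\<close>
  define s0 where "s0 = min (D / (\<phi> + 1)) (D / (4 * 4 ^ CARD('n)))"
  have s0: "0 < s0" using D \<phi> by (simp add: s0_def)
  define B where "B = 4 / (b * Z) * (1 + (8 / b) powr (d / \<alpha>))"
  have B: "0 < B" using b Z by (simp add: B_def add_pos_nonneg)
  have small: "ennreal (LINT x|mu V. (f x)\<^sup>2)
            \<le> ennreal s * energy \<alpha> V f
              + ennreal (B * beta \<alpha> V 1 D s * (LINT x|mu V. \<bar>f x\<bar>)\<^sup>2)"
    if s: "0 < s" "s \<le> s0" and f: "f \<in> Cb_infty" for s f
  proof -
    note [measurable] = Cb_infty_measurable[OF f]
    define t where "t = D * inverse s"
    have t: "0 < t" "\<phi> < t" "4 * 4 ^ CARD('n) \<le> t"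
      using s D \<phi>(2) by (auto simp: t_def s0_def field_simps)
    define R where "R = Phi_inv V t"
    \<comment> \<open>Below radius \<open>3/4\<close> the ball used in \<open>outer_bound\<close> leaves the shell; this is why \<open>s0\<close> involves \<open>Phi V 1\<close>.\<close>
    have R: "1 \<le> R" unfolding R_def
    proof (rule Phi_inv_ge[OF lim])
      fix r assume r: "ennreal t \<le> Phi V r"
      show "1 \<le> r"
      proof (rule ccontr)
        assume "\<not> 1 \<le> r"
        then have "Phi V r \<le> ennreal \<phi>" using Phi_mono[of r 1 V] \<phi> by simp
        with r have "ennreal t \<le> ennreal \<phi>" by (rule order_trans)
        then show False using t \<phi>(2) by simp
      qed
    qed
    define k K where "k = k_fun V R" and "K = K_fun V R"
    have k: "0 < k" unfolding k_def using loc R by (intro k_fun_pos) auto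
    have kK: "k \<le> K" unfolding k_def K_def
      using k_fun_le[of 0 R V] le_K_fun[OF loc, of 0 R] R by simp
    \<comment> \<open>The second entry solves
      \<open>4 * K / (b * k) * \<epsilon> powr \<alpha> = s / 2\<close>; the cap at 1 is the range
      of the jumps.\<close>
    define \<epsilon> where "\<epsilon> = min 1 ((s * b * k / (8 * K)) powr (1 / \<alpha>))"
    have q: "0 < s * b * k / (8 * K)" using s b k kK by simp
    have \<epsilon>: "0 < \<epsilon>" "\<epsilon> \<le> 1" using q by (auto simp: \<epsilon>_def simp del: zero_less_divide_iff)
    have decay: "t * p v \<le> p u" if "R < norm v" "norm v - 1 \<le> norm u" "norm u \<le> norm v - 1/2" for u v
      using shell_decay[OF Phi_inv_less[OF lim], of t v u] that t(1) Z
      by (simp add: p_def R_def Z_def mult.left_commute)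
    obtain F where F: "\<And>x. \<bar>f x\<bar> \<le> F" using Cb_infty_bounded[OF f] unfolding bounded_iff by auto
    have "norm ((f x)\<^sup>2) \<le> F\<^sup>2" for x
      using power_mono[OF F[of x], of 2] by simp
    then have bd2: "bounded (range (\<lambda>x. (f x)\<^sup>2))" unfolding bounded_iff by blast
    have bd1: "bounded (range (\<lambda>x. \<bar>f x\<bar>))" unfolding bounded_iff using F by auto
    define I where "I = (LINT x|mu V. \<bar>f x\<bar>)"
    have "ennreal (LINT x|mu V. (f x)\<^sup>2)
       \<le> ennreal (8 * 4 ^ DIM(real^'n) / (t * unit_ball_vol DIM(real^'n))
            + 4 * (Z * K) / (unit_ball_vol DIM(real^'n) * (Z * k)) * \<epsilon> powr \<alpha>) * energy \<alpha> V f
         + ennreal (4 * (Z * K) / (unit_ball_vol DIM(real^'n) * (Z * k)\<^sup>2) * \<epsilon> powr (- real DIM(real^'n)) * I\<^sup>2)"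
    proof (rule super_poincare_split[where f = f and p = p and R = R])
      show "jump_energy \<epsilon> p f \<le> ennreal (2 * \<epsilon> powr (real DIM(real^'n) + \<alpha>)) * energy \<alpha> V f"
        if "0 < \<epsilon>" "\<epsilon> \<le> 1" for \<epsilon>
        unfolding p_def[abs_def] using that \<alpha>
        by (intro jump_energy_le_energy[OF V integrable_exp]) auto
      show "(\<integral>\<^sup>+ x. ennreal ((f x)\<^sup>2 * p x) \<partial>lborel) = ennreal (LINT x|mu V. (f x)\<^sup>2)"
        unfolding p_def by (rule nn_integral_density_bounded[OF V integrable_exp _ bd2]) auto
      show "(\<integral>\<^sup>+ x. ennreal (\<bar>f x\<bar> * p x) \<partial>lborel) = ennreal I"
        unfolding p_def I_def by (rule nn_integral_density_bounded[OF V integrable_exp _ bd1]) auto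
      show "0 < Z * k" using Z k by simp
      show "t * p v \<le> p u" if "R < norm v" "norm v - 1 \<le> norm u" "norm u \<le> norm v - 1/2" for u v
        using that by (rule decay)
    qed (use p p0 R t \<epsilon> scaled_bounds in \<open>auto simp: p_def Z_def k_def K_def I_def\<close>)
    \<comment> \<open>The normalising constant cancels in the energy term and survives as
      \<open>1 / Z\<close> in the other.\<close>
    also have "\<dots> = ennreal (8 * 4 ^ CARD('n) / (t * b) + 4 * K / (b * k) * \<epsilon> powr \<alpha>) * energy \<alpha> V f
         + ennreal (4 * K / (b * Z * k\<^sup>2) * \<epsilon> powr (- d) * I\<^sup>2)"
      using Z by (simp add: b_def d_def power2_eq_square mult_ac)
    also have "\<dots> \<le> ennreal s * energy \<alpha> V f + ennreal (B * beta \<alpha> V 1 D s * I\<^sup>2)"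
    proof (intro add_mono mult_right_mono ennreal_leI)
      have cancel: "(x powr (1 / \<alpha>)) powr \<alpha> = x" if "0 < x" for x
        using that \<alpha> by (simp add: powr_powr)
      have "\<epsilon> powr \<alpha> \<le> ((s * b * k / (8 * K)) powr (1 / \<alpha>)) powr \<alpha>"
        using \<epsilon> \<alpha> by (intro powr_mono2) (auto simp: \<epsilon>_def)
      also have "\<dots> = s * b * k / (8 * K)" by (rule cancel[OF q])
      finally have "4 * K / (b * k) * \<epsilon> powr \<alpha> \<le> 4 * K / (b * k) * (s * b * k / (8 * K))"
        using b k kK by (intro mult_left_mono) auto
      also have "\<dots> = s / 2" using b k kK by (simp add: field_simps)
      finally show "8 * 4 ^ CARD('n) / (t * b) + 4 * K / (b * k) * \<epsilon> powr \<alpha> \<le> s"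
        using s b by (simp add: t_def D_def field_simps)
      \<comment> \<open>A negative power of a minimum is at most the sum of the powers of its
        entries.\<close>
      have "\<epsilon> powr (- d) \<le> 1 + (s * b * k / (8 * K)) powr (- d / \<alpha>)"
      proof (cases "(s * b * k / (8 * K)) powr (1 / \<alpha>) \<le> 1")
        case True
        then have "\<epsilon> powr (- d) = (s * b * k / (8 * K)) powr (- d / \<alpha>)"
          by (simp add: \<epsilon>_def min_absorb2 powr_powr)
        then show ?thesis by simp
      qed (simp add: \<epsilon>_def)
      also have "(s * b * k / (8 * K)) powr (- d / \<alpha>)
          = s powr (- d / \<alpha>) * (8 / b) powr (d / \<alpha>) * (K / k) powr (d / \<alpha>)"
      proof -
        have "(s / (u * v)) powr (- e) = s powr (- e) * u powr e * v powr e"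
          if "0 < u" "0 < v" for u v e :: real
          using that s(1) by (simp add: powr_divide powr_mult powr_minus field_simps)
        from this[of "8 / b" "K / k" "d / \<alpha>"] show ?thesis
          using b k kK by (simp add: mult_ac)
      qed
      \<comment> \<open>Uses \<open>1 + x * y * z \<le> (1 + x) * (1 + y) * z\<close> for
        \<open>z \<ge> 1\<close>, which splits off the factor in \<open>s\<close> as it stands in
        \<open>beta\<close>.\<close>
      also have "1 + s powr (- d / \<alpha>) * (8 / b) powr (d / \<alpha>) * (K / k) powr (d / \<alpha>)
          \<le> (1 + s powr (- d / \<alpha>)) * (1 + (8 / b) powr (d / \<alpha>)) * (K / k) powr (d / \<alpha>)"
      proof -
        have "1 \<le> (K / k) powr (d / \<alpha>)" using k kK d \<alpha> by (intro ge_one_powr_ge_zero) auto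
        then have "1 + x * y * (K / k) powr (d / \<alpha>) \<le> (1 + x) * (1 + y) * (K / k) powr (d / \<alpha>)"
          if "0 \<le> x" "0 \<le> y" for x y
          using that by (simp add: algebra_simps add_increasing2)
        then show ?thesis by simp
      qed
      also have "(K / k) powr (d / \<alpha>) = K powr (d / \<alpha>) * k powr (- d / \<alpha>)"
        using k kK by (simp add: powr_divide powr_minus_divide)
      finally have "\<epsilon> powr (- d) \<le> (1 + s powr (- d / \<alpha>)) * (1 + (8 / b) powr (d / \<alpha>))
          * (K powr (d / \<alpha>) * k powr (- d / \<alpha>))" .
      then have "4 * K / (b * Z * k\<^sup>2) * \<epsilon> powr (- d) \<le> 4 * K / (b * Z * k\<^sup>2) *
         ((1 + s powr (- d / \<alpha>)) * (1 + (8 / b) powr (d / \<alpha>)) * (K powr (d / \<alpha>) * k powr (- d / \<alpha>)))"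
        using b Z k kK by (intro mult_left_mono) auto
      also have "\<dots> = B * ((1 + s powr (- d / \<alpha>)) * 1 * (K powr (1 + d / \<alpha>)) * k powr (- 2 - d / \<alpha>))"
        using k kK by (simp add: B_def powr_add powr_diff powr_minus_divide powr_numeral mult_ac)
      \<comment> \<open>As \<open>1 \<le> R\<close>, inserting the power of \<open>R\<close> from
        \<open>beta\<close> can only increase the bound.\<close>
      also have "\<dots> \<le> B * ((1 + s powr (- d / \<alpha>)) * R powr (d + d\<^sup>2 / \<alpha>) * (K powr (1 + d / \<alpha>)) * k powr (- 2 - d / \<alpha>))"
        using R B d \<alpha> by (intro mult_left_mono mult_right_mono ge_one_powr_ge_zero) auto
      also have "\<dots> = B * beta \<alpha> V 1 D s"
        by (simp add: beta_def Let_def d_def[symmetric] t_def[symmetric] R_def[symmetric]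
            k_def[symmetric] K_def[symmetric])
      finally show "4 * K / (b * Z * k\<^sup>2) * \<epsilon> powr (- d) \<le> B * beta \<alpha> V 1 D s" .
    qed simp_all
    finally show ?thesis unfolding I_def .
  qed
  \<comment> \<open>For \<open>s > s0\<close> the inequality at \<open>s0\<close> suffices, because \<open>beta\<close> is bounded away from 0.\<close>
  define m where "m = (1/2) powr (d + d\<^sup>2 / \<alpha>) / exp (- V 0)"
  have m: "0 < m" by (simp add: m_def)
  have m_le: "m \<le> beta \<alpha> V 1 D s" for s
    unfolding m_def d_def by (rule beta_ge[OF loc \<alpha> lim])
  \<comment> \<open>\<open>B\<close> serves for \<open>s \<le> s0\<close>. The second entry times
    \<open>m\<close> is the coefficient at \<open>s0\<close>, so its product with
    \<open>beta\<close> at any larger \<open>s\<close> dominates that coefficient.\<close>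
  define C where "C = max B (B * beta \<alpha> V 1 D s0 / m)"
  have "0 < C" using B by (simp add: C_def)
  have "ennreal (LINT x|mu V. (f x)\<^sup>2) \<le> ennreal s * energy \<alpha> V f
              + ennreal (beta \<alpha> V C D s * (LINT x|mu V. \<bar>f x\<bar>)\<^sup>2)"
    if s: "0 < s" and f: "f \<in> Cb_infty" for s f
  proof (cases "s \<le> s0")
    case True
    have "B * beta \<alpha> V 1 D s \<le> beta \<alpha> V C D s"
      unfolding beta_mult[of _ _ C] using m m_le[of s] by (intro mult_right_mono) (auto simp: C_def)
    then have "ennreal (B * beta \<alpha> V 1 D s * (LINT x|mu V. \<bar>f x\<bar>)\<^sup>2)
      \<le> ennreal (beta \<alpha> V C D s * (LINT x|mu V. \<bar>f x\<bar>)\<^sup>2)"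
      by (intro ennreal_leI mult_right_mono) auto
    then show ?thesis
      using small[OF s True f] by (meson add_left_mono order_trans)
  next
    case False
    have "B * beta \<alpha> V 1 D s0 = B * beta \<alpha> V 1 D s0 / m * m" using m by simp
    also have "\<dots> \<le> C * beta \<alpha> V 1 D s"
      using m m_le[of s] m_le[of s0] B by (intro mult_mono) (auto simp: C_def)
    finally have "B * beta \<alpha> V 1 D s0 \<le> beta \<alpha> V C D s"
      by (simp flip: beta_mult)
    then have "ennreal (B * beta \<alpha> V 1 D s0 * (LINT x|mu V. \<bar>f x\<bar>)\<^sup>2)
      \<le> ennreal (beta \<alpha> V C D s * (LINT x|mu V. \<bar>f x\<bar>)\<^sup>2)"
      by (intro ennreal_leI mult_right_mono) auto
    moreover have "ennreal s0 * energy \<alpha> V f \<le> ennreal s * energy \<alpha> V f"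
      using False by (intro mult_right_mono ennreal_leI) auto
    ultimately show ?thesis
      using small[OF s0 order_refl f] by (meson add_mono order_trans)
  qed
  then show ?thesis using \<open>0 < C\<close> D by blast
qed

end

theorem theorem1p1:
  fixes V :: "real^'n::finite \<Rightarrow> real" and \<alpha> :: real
  assumes "0 < \<alpha>" and "\<alpha> < 2"
    and "V \<in> borel_measurable borel"
    and "locally_bounded V"
    and "integrable lborel (\<lambda>x. exp (- V x))"
  shows
    "(liminf_ratio V > ennreal (1 / \<alpha> * 2 ^ (2 * CARD('n) + 1) * (exp 1 + exp (1/2)) * (2 powr \<alpha> - 1))
        \<longrightarrow> (\<exists>C1>0. \<forall>f\<in>Cb_infty. (LINT x|mu V. f x) = 0 \<longrightarrow>
              ennreal (LINT x|mu V. (f x)\<^sup>2) \<le> ennreal C1 * energy \<alpha> V f))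
     \<and> (liminf_ratio V = \<infinity>
        \<longrightarrow> (\<exists>C2>0. \<exists>C3>0. \<forall>s>0. \<forall>f\<in>Cb_infty.
              ennreal (LINT x|mu V. (f x)\<^sup>2)
                \<le> ennreal s * energy \<alpha> V f
                   + ennreal (beta \<alpha> V C2 C3 s * (LINT x|mu V. \<bar>f x\<bar>)\<^sup>2)))"
proof (intro conjI impI)
  assume "liminf_ratio V > ennreal (1 / \<alpha> * 2 ^ (2 * CARD('n) + 1) * (exp 1 + exp (1/2)) * (2 powr \<alpha> - 1))"
  with ennreal_leI[OF poincare_threshold[OF assms(1)]] have "ennreal (4 ^ CARD('n)) < liminf_ratio V"
    by (rule le_less_trans)
  from poincare[OF assms(1,3-5) this] show "\<exists>C1>0. \<forall>f\<in>Cb_infty. (LINT x|mu V. f x) = 0 \<longrightarrow>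
              ennreal (LINT x|mu V. (f x)\<^sup>2) \<le> ennreal C1 * energy \<alpha> V f" .
qed (rule super_poincare[OF assms(1,3-5)])

end
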